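(* Fix $n$. Let $\lambda,\mu,\nu$ be partitions of length at most $n$. Then the function $$(1^{\lambda_1}\,0\,1^{\lambda_2}\,0\,\dots\,0\,1^{\lambda_n}\,0\,1^{\mu_1}\,0\,\dots\,0\,1^{\mu_n}\,0\,1^{\nu_1}\,0\,\dots\,0\,1^{\nu_n})\ \mapsto\ c_{\mu,\nu}^{\lambda}$$ is in $\#\mathsf{L}$.
   Context: $c_{\mu,\nu}^\lambda$ is the ($\mathrm{GL}_n$-)Littlewood--Richardson coefficient: the structure constants of the product of Schur polynomials, $s_\mu(x_1,\dots,x_n)\,s_\nu(x_1,\dots,x_n)=\sum_\lambda c_{\mu,\nu}^\lambda\,s_\lambda(x_1,\dots,x_n)$, the sum over partitions $\lambda$ of length at most $n$. The alphabet is $\Sigma=\{0,1\}$; $1^a$ is the string of $a$ ones and juxtaposition is concatenation. A function given only on strings of a specified form is extended by $0$ to all other strings. $\#\mathsf{L}$ is the class of functions $f:\Sigma^*\to\mathbb{N}_0$ such that $f(x)$ is the number of accepting computation paths on input $x$ of a fixed nondeterministic Turing machine with read-only input tape that uses $O(\log|x|)$ work space and halts on every computation path. Equivalently: there are a polynomial $q$ and a deterministic $O(\log|x|)$-space Turing machine $M$ with an additional read-once, left-to-right witness tape such that $f(x)=\#\{w\in\Sigma^{q(|x|)}\mid M(x,w)=\mathsf{yes}\}$. *)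

theory Defs
  imports
    "HOL-Library.Landau_Symbols"
    "HOL-Library.FuncSet"
    "HOL-Library.Poly_Mapping"
begin

section \<open>Schur polynomials and Littlewood--Richardson coefficients\<close>

text \<open>Partitions of length at most \<open>n\<close>, padded with zeros to exactly \<open>n\<close> parts.\<close>

definition partitions :: "nat \<Rightarrow> nat list set" where
  "partitions n = {lam. length lam = n \<and> sorted_wrt (\<ge>) lam}"

definition cells :: "nat list \<Rightarrow> (nat \<times> nat) set" where
  "cells lam = {(i, j). i < length lam \<and> j < lam ! i}"

text \<open>Semistandard tableaux in English notation: the cell \<open>(i, j)\<close> lies in row \<open>i\<close> and
  column \<open>j\<close>, both counted from 0.\<close>

definition ssyt :: "nat \<Rightarrow> nat list \<Rightarrow> (nat \<times> nat \<Rightarrow> nat) set" where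
  "ssyt n lam = {T \<in> cells lam \<rightarrow>\<^sub>E {1..n}.
     (\<forall>i j. (i, j) \<in> cells lam \<and> (i, Suc j) \<in> cells lam \<longrightarrow> T (i, j) \<le> T (i, Suc j)) \<and>
     (\<forall>i j. (i, j) \<in> cells lam \<and> (Suc i, j) \<in> cells lam \<longrightarrow> T (i, j) < T (Suc i, j))}"

text \<open>Integer polynomials in variables indexed by \<^typ>\<open>nat\<close>: finitely supported maps from
  exponent vectors to coefficients, with the convolution product of
  \<^theory>\<open>HOL-Library.Poly_Mapping\<close>.\<close>

type_synonym mpoly = "(nat \<Rightarrow>\<^sub>0 nat) \<Rightarrow>\<^sub>0 int"

definition X :: "nat \<Rightarrow> mpoly" where
  "X i = Poly_Mapping.single (Poly_Mapping.single i 1) 1"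

definition schur :: "nat \<Rightarrow> nat list \<Rightarrow> mpoly" where
  "schur n lam = (\<Sum>T\<in>ssyt n lam. \<Prod>c\<in>cells lam. X (T c))"

text \<open>\<open>lr_coeff n mu nu lam\<close> is the coefficient of \<open>schur n lam\<close> in the unique expansion of
  \<open>schur n mu * schur n nu\<close> in Schur polynomials.\<close>

definition lr_coeff :: "nat \<Rightarrow> nat list \<Rightarrow> nat list \<Rightarrow> nat list \<Rightarrow> nat" where
  "lr_coeff n mu nu =
     (THE c. finite {lam. c lam \<noteq> 0} \<and> {lam. c lam \<noteq> 0} \<subseteq> partitions n \<and>
        schur n mu * schur n nu = (\<Sum>lam | c lam \<noteq> 0. of_nat (c lam) * schur n lam))"

section \<open>Nondeterministic Turing machines and the class \<open>#L\<close>\<close>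

text \<open>A string over \<open>{0, 1}\<close> is a \<^typ>\<open>bool list\<close>, with \<^const>\<open>True\<close> for 1. The read-only
  input tape holds the input between two end markers, which the input head cannot pass.
  There is a fixed number of work tapes, infinite to the right, with blank symbol 0.\<close>

datatype insym = LeftEnd | Bit bool | RightEnd

datatype dir = Left | Stay | Right

text \<open>New state, move of the input head, and for each work tape the written symbol and
  the head move.\<close>

type_synonym action = "nat \<times> dir \<times> (nat \<times> dir) list"

record machine =
  states :: "nat set"
  alphabet :: "nat set"
  tapes :: nat
  start :: nat
  accept :: "nat set"
  delta :: "nat \<Rightarrow> insym \<Rightarrow> nat list \<Rightarrow> action set"

definition ntm :: "machine \<Rightarrow> bool" where
  "ntm M \<longleftrightarrow> finite (states M) \<and> finite (alphabet M) \<and> 0 \<in> alphabet M \<and>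
     start M \<in> states M \<and> accept M \<subseteq> states M \<and>
     (\<forall>q\<in>states M. \<forall>a. \<forall>ws. length ws = tapes M \<and> set ws \<subseteq> alphabet M \<longrightarrow>
        delta M q a ws \<subseteq> {(q', d, acts). q' \<in> states M \<and> length acts = tapes M \<and>
                                       fst ` set acts \<subseteq> alphabet M})"

text \<open>State, position of the input head, and contents and head position of each work tape.\<close>

type_synonym config = "nat \<times> nat \<times> ((nat \<Rightarrow> nat) \<times> nat) list"

definition initial :: "machine \<Rightarrow> config" where
  "initial M = (start M, 0, replicate (tapes M) (\<lambda>_. 0, 0))"

text \<open>The input \<open>x\<close> occupies cells 1 to \<open>length x\<close>.\<close>

definition read_input :: "bool list \<Rightarrow> nat \<Rightarrow> insym" where
  "read_input x i =
     (if i = 0 then LeftEnd else if i \<le> length x then Bit (x ! (i - 1)) else RightEnd)"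

text \<open>A head on cell 0 that is told to move left stays where it is.\<close>

fun move :: "dir \<Rightarrow> nat \<Rightarrow> nat" where
  "move Left i = i - 1"
| "move Stay i = i"
| "move Right i = Suc i"

fun enabled :: "machine \<Rightarrow> bool list \<Rightarrow> config \<Rightarrow> action set" where
  "enabled M x (q, i, ts) = delta M q (read_input x i) (map (\<lambda>(t, h). t h) ts)"

fun perform :: "bool list \<Rightarrow> action \<Rightarrow> config \<Rightarrow> config" where
  "perform x (q', d, acts) (q, i, ts) =
     (q', min (move d i) (length x + 1),
      map2 (\<lambda>(s, e) (t, h). (t(h := s), move e h)) acts ts)"

text \<open>A computation path is the sequence of the transitions taken.\<close>

inductive path :: "machine \<Rightarrow> bool list \<Rightarrow> config \<Rightarrow> action list \<Rightarrow> config \<Rightarrow> bool"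
  for M x where
  path_Nil: "path M x c [] c"
| path_Cons: "a \<in> enabled M x c \<Longrightarrow> path M x (perform x a c) as c' \<Longrightarrow> path M x c (a # as) c'"

definition accepting_paths :: "machine \<Rightarrow> bool list \<Rightarrow> action list set" where
  "accepting_paths M x =
     {as. \<exists>c. path M x (initial M) as c \<and> enabled M x c = {} \<and> fst c \<in> accept M}"

definition halts_on_every_path :: "machine \<Rightarrow> bool list \<Rightarrow> bool" where
  "halts_on_every_path M x \<longleftrightarrow>
     \<not> (\<exists>cs :: nat \<Rightarrow> config. cs 0 = initial M \<and>
          (\<forall>k. \<exists>a\<in>enabled M x (cs k). cs (Suc k) = perform x a (cs k)))"

text \<open>On every computation path each work head stays within the first \<open>b\<close> cells of its tape;
  the input tape is not counted.\<close>

definition space_le :: "machine \<Rightarrow> bool list \<Rightarrow> nat \<Rightarrow> bool" where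
  "space_le M x b \<longleftrightarrow>
     (\<forall>as q i ts. path M x (initial M) as (q, i, ts) \<longrightarrow> (\<forall>(t, h)\<in>set ts. h < b))"

definition sharpL :: "(bool list \<Rightarrow> nat) set" where
  "sharpL = {f. \<exists>M s. ntm M \<and> (\<lambda>m. real (s m)) \<in> O(\<lambda>m. ln (real m)) \<and>
     (\<forall>x. halts_on_every_path M x \<and> space_le M x (s (length x)) \<and>
          f x = card (accepting_paths M x))}"

section \<open>Encoding of the input\<close>

text \<open>\<open>unary_join [a, b, c]\<close> is the string \<open>1\<^sup>a 0 1\<^sup>b 0 1\<^sup>c\<close>.\<close>

fun unary_join :: "nat list \<Rightarrow> bool list" where
  "unary_join [] = []"
| "unary_join [k] = replicate k True"
| "unary_join (k # l # ks) = replicate k True @ False # unary_join (l # ks)"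

definition encode :: "nat list \<Rightarrow> nat list \<Rightarrow> nat list \<Rightarrow> bool list" where
  "encode lam mu nu = unary_join (lam @ mu @ nu)"

lemma replicate_True_False_inj:
  "replicate a True @ False # u = replicate b True @ False # v \<Longrightarrow> a = b \<and> u = v"
proof (induction a arbitrary: b)
  case 0
  then show ?case by (cases b) auto
next
  case (Suc a)
  then show ?case by (cases b) auto
qed

lemma unary_join_inj:
  "length ks = length ls \<Longrightarrow> unary_join ks = unary_join ls \<Longrightarrow> ks = ls"
proof (induction ks arbitrary: ls rule: unary_join.induct)
  case 1
  then show ?case by simp
next
  case (2 k)
  then obtain k' where "ls = [k']" by (cases ls) auto
  with 2 show ?case by (auto dest: arg_cong[of _ _ length])
next
  case (3 k l ks)
  then obtain k' l' ks' where ls: "ls = k' # l' # ks'"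
    by (cases ls; cases "tl ls") auto
  have "replicate k True @ False # unary_join (l # ks) =
      replicate k' True @ False # unary_join (l' # ks')"
    using 3(3) unfolding ls unary_join.simps .
  from replicate_True_False_inj[OF this]
  have *: "k = k'" "unary_join (l # ks) = unary_join (l' # ks')" by blast+
  have "l # ks = l' # ks'"
    by (rule 3(1)) (use 3(2) ls * in simp_all)
  with * ls show ?case by simp
qed

text \<open>For fixed \<open>n\<close>, a function on strings is thus determined by its values on the encodings
  and its vanishing elsewhere.\<close>

lemma encode_inj:
  assumes "lam \<in> partitions n" "mu \<in> partitions n" "nu \<in> partitions n"
    and "lam' \<in> partitions n" "mu' \<in> partitions n" "nu' \<in> partitions n"
    and "encode lam mu nu = encode lam' mu' nu'"
  shows "lam = lam' \<and> mu = mu' \<and> nu = nu'"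
  using unary_join_inj[of "lam @ mu @ nu" "lam' @ mu' @ nu'"] assms
  by (auto simp: encode_def partitions_def)

end

theory Submission
  imports Defs "HOL-Combinatorics.Permutations" "HOL-Library.Countable"
begin

text \<open>The Littlewood--Richardson rule is proved by Stembridge's involution, carried out on
  Gelfand--Tsetlin patterns instead of tableaux. Multiplying an alternant by a Schur polynomial
  gives the sum of the alternants shifted by the weights of all patterns. The patterns violating the
  lattice condition cancel in pairs: a Bender--Knuth move applied to the columns left of the
  rightmost violation swaps two adjacent entries of the shifted exponent. What remains counts the
  coefficient by integer points of a system of homogeneous linear inequalities in the parts of
  \<open>lam\<close>, \<open>mu\<close>, \<open>nu\<close> and the entries of the pattern.

  Such a system, with a fixed number of unknowns, is decided in one sweep over binary numbers
  starting from the least significant digit: each inequality only needs to remember a carry, which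
  is bounded. So a machine converts the unary input to binary, then sweeps once while guessing the
  digits of the pattern and never storing them; its accepting paths are the solutions.\<close>

section \<open>Interlacing sequences and the Bender--Knuth involution\<close>

text \<open>Patterns serve both halves. The Bender-Knuth move becomes a reflection of single entries
  in intervals cut out by their neighbours, and counting tableaux becomes counting integer points in
  a number of unknowns that depends on \<open>n\<close> only. The obstacle in between is the lattice
  condition: it speaks about every column, and the number of columns grows with the input, through
  truncated differences that are not linear. It has to be traded for a fixed list of linear
  inequalities. The pairing works because the deficit at the rightmost violation is exactly 1, the
  step of the staircase \<open>rho\<close>. The same cancellation with \<open>mu\<close> zero gives
  the bialternant formula, and through it the uniqueness hidden in \<open>lr_coeff\<close>. On the
  machine side, the sweep stops when the given numbers have no digits left, so a longer unknown
  would be missed. Here every pattern entry is at most a part of \<open>nu\<close>. Sequences that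
  are not partitions are rejected by the system itself, which contains the inequalities between
  consecutive parts.\<close>

definition interlacing :: "(nat \<Rightarrow> nat) \<Rightarrow> (nat \<Rightarrow> nat) \<Rightarrow> bool" where
  "interlacing a c \<longleftrightarrow> (\<forall>i. c i \<le> a i \<and> a (Suc i) \<le> c i)"

text \<open>\<open>interlacing a c\<close> says that \<open>a / c\<close> is a horizontal strip, the
  shape formed by one letter. With \<open>a\<close> and \<open>b\<close> fixed, an entry
  \<open>c i\<close> therefore moves freely between \<open>max (a (Suc i)) (b i)\<close> and this
  cap; for \<open>i = 0\<close> there is no row above to restrict it.\<close>

definition toggle_cap :: "(nat \<Rightarrow> nat) \<Rightarrow> (nat \<Rightarrow> nat) \<Rightarrow> nat \<Rightarrow> nat" where
  "toggle_cap a b i = (if i = 0 then a 0 else min (a i) (b (i - 1)))"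

text \<open>The entry is reflected in its interval, as in the Bender-Knuth move, but with the
  interval cut off at \<open>j\<close>: only cells in the columns before \<open>j\<close> change,
  and an entry beyond \<open>j\<close> stays fixed.\<close>

definition toggle :: "nat \<Rightarrow> (nat \<Rightarrow> nat) \<Rightarrow> (nat \<Rightarrow> nat) \<Rightarrow> (nat \<Rightarrow> nat) \<Rightarrow> nat \<Rightarrow> nat" where
  "toggle j a b c i =
     (if c i \<le> j then min (toggle_cap a b i) j + max (a (Suc i)) (b i) - c i else c i)"

lemma interlacing_antimono:
  assumes "interlacing a c" "i \<le> k"
  shows "a k \<le> a i"
  using assms(2) by (rule lift_Suc_antimono_le[rotated])
    (use assms(1) in \<open>auto simp: interlacing_def intro: order_trans\<close>)

lemma toggle_cap_le: "toggle_cap a b i \<le> a i"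
  by (simp add: toggle_cap_def)

lemma toggle_cap_Suc_le: "toggle_cap a b (Suc i) \<le> b i"
  by (simp add: toggle_cap_def)

lemma le_toggle_cap:
  assumes "interlacing a c" "interlacing c b"
  shows "c i \<le> toggle_cap a b i"
  using assms by (cases i) (auto simp: toggle_cap_def interlacing_def)

lemma max_le_of_interlacing:
  assumes "interlacing a c" "interlacing c b"
  shows "max (a (Suc i)) (b i) \<le> c i"
  using assms by (auto simp: interlacing_def)

lemma toggle_add:
  assumes "interlacing a c" "interlacing c b" "c i \<le> j"
  shows "toggle j a b c i + c i = min (toggle_cap a b i) j + max (a (Suc i)) (b i)"
  using le_toggle_cap[OF assms(1,2), of i] max_le_of_interlacing[OF assms(1,2), of i] assms(3)
  by (simp add: toggle_def del: max.bounded_iff min_less_iff_conj)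

lemma toggle_le_iff:
  assumes "interlacing a c" "interlacing c b"
  shows "toggle j a b c i \<le> j \<longleftrightarrow> c i \<le> j"
  using max_le_of_interlacing[OF assms, of i]
  unfolding toggle_def by (auto split: if_splits)

lemma toggle_bounds:
  assumes "interlacing a c" "interlacing c b"
  shows "max (a (Suc i)) (b i) \<le> toggle j a b c i" "toggle j a b c i \<le> toggle_cap a b i"
  using le_toggle_cap[OF assms, of i] max_le_of_interlacing[OF assms, of i]
  unfolding toggle_def by (simp_all del: max.bounded_iff; linarith)+

lemma toggle_interlacing:
  assumes "interlacing a c" "interlacing c b"
  shows "interlacing a (toggle j a b c)" "interlacing (toggle j a b c) b"
proof -
  have *: "toggle j a b c i \<le> a i" "toggle j a b c (Suc i) \<le> b i" for i
    by (rule order_trans[OF toggle_bounds(2)[OF assms]], rule toggle_cap_le toggle_cap_Suc_le)+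
  show "interlacing a (toggle j a b c)" "interlacing (toggle j a b c) b"
    using * toggle_bounds(1)[OF assms, of _ j] by (auto simp: interlacing_def)
qed

text \<open>The reflected entry stays on the same side of \<open>j\<close>, so the second
  application reflects it in the same interval.\<close>

lemma toggle_toggle:
  assumes "interlacing a c" "interlacing c b"
  shows "toggle j a b (toggle j a b c) = c"
proof
  fix i
  show "toggle j a b (toggle j a b c) i = c i"
  proof (cases "c i \<le> j")
    case True
    then have "toggle j a b c i \<le> j"
      using toggle_le_iff[OF assms] by blast
    then show ?thesis
      using toggle_add[OF assms True] toggle_add[OF toggle_interlacing[OF assms]]
      by (metis add.commute add_left_cancel)
  qed (simp add: toggle_def)
qed

text \<open>Guarantees that the letters in the columns from \<open>j\<close> on, hence all
  violations there, survive the move.\<close>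

lemma toggle_diff:
  assumes "interlacing a c" "interlacing c b" "j \<le> j'"
  shows "toggle j a b c i - j' = c i - j'"
  using toggle_le_iff[OF assms(1,2), of j i] assms(3) by (cases "c i \<le> j") (auto simp: toggle_def)

text \<open>The cap of row \<open>i + 1\<close> and the floor of row \<open>i\<close> are the
  minimum and the maximum of the same pair \<open>a (Suc i)\<close>, \<open>b i\<close>, so together
  they give its sum.\<close>

lemma sum_min_max_telescope:
  fixes a b :: "nat \<Rightarrow> nat"
  shows "(\<Sum>i<Suc m. (if i = 0 then a 0 else min (a i) (b (i - 1))) + max (a (Suc i)) (b i)) =
    (\<Sum>i<Suc m. a i) + (\<Sum>i<m. b i) + max (a (Suc m)) (b m)"
  by (induction m) (auto simp: min_def max_def)

text \<open>After truncation at \<open>j\<close> every row contributes cap plus floor: a moved row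
  by reflection, and a row with \<open>j < c i\<close> because \<open>no\<close> shrinks its
  truncated interval to the single value \<open>j\<close>. The condition \<open>a n = 0\<close>
  closes the telescope.\<close>

lemma sum_toggle:
  assumes "interlacing a c" "interlacing c b" "a n = 0"
    and no: "\<And>i. j < c i \<Longrightarrow> j \<le> b i"
  shows "(\<Sum>i<n. min (c i) j) + (\<Sum>i<n. min (toggle j a b c i) j) =
    (\<Sum>i<n. min (a i) j) + (\<Sum>i<n. min (b i) j)"
proof (cases n)
  case (Suc m)
  define A where "A i = min (a i) j" for i
  define B where "B i = min (b i) j" for i
  have "min (c i) j + min (toggle j a b c i) j =
      (if i = 0 then A 0 else min (A i) (B (i - 1))) + max (A (Suc i)) (B i)" for i
  proof -
    have cap: "(if i = 0 then A 0 else min (A i) (B (i - 1))) = min (toggle_cap a b i) j"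
      by (auto simp: A_def B_def toggle_cap_def)
    show ?thesis
    proof (cases "c i \<le> j")
      case True
      then have "toggle j a b c i \<le> j"
        using toggle_le_iff[OF assms(1,2)] by blast
      then show ?thesis
        unfolding cap
        using True toggle_add[OF assms(1,2) True] max_le_of_interlacing[OF assms(1,2), of i]
        unfolding A_def B_def by linarith
    next
      case False
      then have "toggle j a b c i = c i" by (simp add: toggle_def)
      then show ?thesis
        unfolding cap using False no[of i] le_toggle_cap[OF assms(1,2), of i]
        unfolding A_def B_def by linarith
    qed
  qed
  then have "(\<Sum>i<n. min (c i) j) + (\<Sum>i<n. min (toggle j a b c i) j) =
      (\<Sum>i<n. A i) + (\<Sum>i<m. B i) + max (A n) (B m)"
    unfolding sum.distrib[symmetric] using sum_min_max_telescope[of A B m] Suc by simp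
  also have "A n = 0" using assms(3) by (simp add: A_def)
  finally show ?thesis using Suc by (simp add: A_def B_def)
qed simp


section \<open>Gelfand--Tsetlin patterns\<close>

text \<open>\<open>g k i\<close> is the number of entries at most \<open>k\<close> in row \<open>i\<close> of the corresponding tableau.\<close>

definition gt :: "nat \<Rightarrow> nat list \<Rightarrow> (nat \<Rightarrow> nat \<Rightarrow> nat) set" where
  "gt n nu = {g. (\<forall>i. g 0 i = 0) \<and> (\<forall>i<n. g n i = nu ! i) \<and>
     (\<forall>k i. n < k \<or> n \<le> i \<longrightarrow> g k i = 0) \<and> (\<forall>k<n. interlacing (g (Suc k)) (g k))}"

text \<open>Letters are counted from 0, so letter \<open>k\<close> is the tableau entry \<open>k + 1\<close>; \<open>col_wt n g j k\<close>
  counts it in the columns from \<open>j\<close> on.\<close>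

definition wt :: "nat \<Rightarrow> (nat \<Rightarrow> nat \<Rightarrow> nat) \<Rightarrow> nat \<Rightarrow> nat" where
  "wt n g k = (\<Sum>i<n. g (Suc k) i - g k i)"

definition col_wt :: "nat \<Rightarrow> (nat \<Rightarrow> nat \<Rightarrow> nat) \<Rightarrow> nat \<Rightarrow> nat \<Rightarrow> int" where
  "col_wt n g j k = (\<Sum>i<n. int (g (Suc k) i - j)) - (\<Sum>i<n. int (g k i - j))"

text \<open>Level \<open>Suc k\<close> of the pattern marks where the letters \<open>k\<close> end
  and the letters \<open>k + 1\<close> begin; the two neighbouring levels bound their common
  territory.\<close>

definition gt_toggle :: "nat \<Rightarrow> nat \<Rightarrow> (nat \<Rightarrow> nat \<Rightarrow> nat) \<Rightarrow> nat \<Rightarrow> nat \<Rightarrow> nat" where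
  "gt_toggle j k g = g(Suc k := toggle j (g (Suc (Suc k))) (g k) (g (Suc k)))"

lemma gt_interlacing: "g \<in> gt n nu \<Longrightarrow> k < n \<Longrightarrow> interlacing (g (Suc k)) (g k)"
  by (simp add: gt_def)

lemma gt_mono:
  assumes "g \<in> gt n nu" "k \<le> l" "l \<le> n"
  shows "g k i \<le> g l i"
  using assms(2,3)
proof (induction l rule: dec_induct)
  case (step l)
  then show ?case
    using gt_interlacing[OF assms(1), of l] by (auto simp: interlacing_def intro: order_trans)
qed simp

lemma gt_eq_0:
  assumes "g \<in> gt n nu" "k \<le> i"
  shows "g k i = 0"
  using assms(2)
proof (induction k arbitrary: i)
  case 0
  then show ?case using assms(1) by (simp add: gt_def)
next
  case (Suc k)
  show ?case
  proof (cases "k < n")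
    case True
    obtain l where l: "i = Suc l" "k \<le> l" using Suc(2) by (cases i) auto
    show ?thesis
      using gt_interlacing[OF assms(1) True] Suc(1)[OF l(2)] l(1)
      by (auto simp: interlacing_def dest: spec[of _ l])
  next
    case False
    then show ?thesis using assms(1) by (auto simp: gt_def)
  qed
qed

lemma int_wt:
  assumes "g \<in> gt n nu" "k < n"
  shows "int (wt n g k) = (\<Sum>i<n. int (g (Suc k) i)) - (\<Sum>i<n. int (g k i))"
proof -
  have "int (g (Suc k) i - g k i) = int (g (Suc k) i) - int (g k i)" for i
    using gt_mono[OF assms(1), of k "Suc k" i] assms(2) by (simp add: of_nat_diff)
  then show ?thesis by (simp add: wt_def sum_subtractf)
qed

lemma col_wt_0: "g \<in> gt n nu \<Longrightarrow> k < n \<Longrightarrow> col_wt n g 0 k = int (wt n g k)"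
  by (simp add: col_wt_def int_wt)

lemma gt_toggle_interlacing:
  assumes "g \<in> gt n nu" "Suc k < n"
  shows "interlacing (g (Suc (Suc k))) (g (Suc k))" "interlacing (g (Suc k)) (g k)"
  using gt_interlacing[OF assms(1)] assms(2) by auto

lemma gt_toggle_in_gt:
  assumes "g \<in> gt n nu" "Suc k < n"
  shows "gt_toggle j k g \<in> gt n nu"
proof -
  note il = gt_toggle_interlacing[OF assms]
  note til = toggle_interlacing[OF il]
  have "interlacing (gt_toggle j k g (Suc l)) (gt_toggle j k g l)" if "l < n" for l
    using that gt_interlacing[OF assms(1)] til[of j] unfolding gt_toggle_def
    by (cases "l = k"; cases "l = Suc k") auto
  moreover have "toggle j (g (Suc (Suc k))) (g k) (g (Suc k)) i = 0" if "n \<le> i" for i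
    using til(1)[of j] that gt_eq_0[OF assms(1), of "Suc (Suc k)" i] assms(2)
    by (auto simp: interlacing_def dest: spec[of _ i])
  ultimately show ?thesis
    using assms by (auto simp: gt_def gt_toggle_def)
qed

lemma gt_toggle_gt_toggle:
  assumes "g \<in> gt n nu" "Suc k < n"
  shows "gt_toggle j k (gt_toggle j k g) = g"
  using toggle_toggle[OF gt_toggle_interlacing[OF assms]] by (auto simp: gt_toggle_def)

lemma col_wt_gt_toggle:
  assumes "g \<in> gt n nu" "Suc k < n" "j \<le> j'"
  shows "col_wt n (gt_toggle j k g) j' = col_wt n g j'"
  using toggle_diff[OF gt_toggle_interlacing[OF assms(1,2)] assms(3)]
  by (auto simp: col_wt_def gt_toggle_def fun_eq_iff)

text \<open>If column \<open>j\<close> has no letter \<open>k\<close>, the columns left of it exchange their numbers of letters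
  \<open>k\<close> and \<open>k + 1\<close>.\<close>

lemma wt_gt_toggle:
  assumes g: "g \<in> gt n nu" and k: "Suc k < n"
    and no: "\<And>i. j < g (Suc k) i \<Longrightarrow> j \<le> g k i"
  shows "int (wt n (gt_toggle j k g) k) =
      int (wt n g (Suc k)) - col_wt n g j (Suc k) + col_wt n g j k"
    and "int (wt n (gt_toggle j k g) (Suc k)) =
      int (wt n g k) - col_wt n g j k + col_wt n g j (Suc k)"
    and "l \<noteq> k \<Longrightarrow> l \<noteq> Suc k \<Longrightarrow> wt n (gt_toggle j k g) l = wt n g l"
proof -
  define a b c where "a = g (Suc (Suc k))" and "b = g k" and "c = g (Suc k)"
  define c' where "c' = toggle j a b c"
  note il = gt_toggle_interlacing[OF g k, folded a_def b_def c_def]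
  have an: "a n = 0" using gt_eq_0[OF g] k by (simp add: a_def)
  have "(\<Sum>i<n. min (c i) j) + (\<Sum>i<n. min (c' i) j) = (\<Sum>i<n. min (a i) j) + (\<Sum>i<n. min (b i) j)"
    unfolding c'_def using sum_toggle[OF il an] no unfolding c_def b_def by blast
  then have "int ((\<Sum>i<n. min (c i) j) + (\<Sum>i<n. min (c' i) j)) =
      int ((\<Sum>i<n. min (a i) j) + (\<Sum>i<n. min (b i) j))"
    by (rule arg_cong)
  then have m: "(\<Sum>i<n. int (min (c i) j)) + (\<Sum>i<n. int (min (c' i) j)) =
      (\<Sum>i<n. int (min (a i) j)) + (\<Sum>i<n. int (min (b i) j))"
    by simp
  have split: "(\<Sum>i<n. int (f i)) = (\<Sum>i<n. int (min (f i) j)) + (\<Sum>i<n. int (f i - j))" for f :: "nat \<Rightarrow> nat"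
    unfolding sum.distrib[symmetric] by (rule sum.cong) auto
  have d: "(\<Sum>i<n. int (c' i - j)) = (\<Sum>i<n. int (c i - j))"
    unfolding c'_def using toggle_diff[OF il order_refl] by simp
  have g': "gt_toggle j k g (Suc k) = c'" "gt_toggle j k g k = b" "gt_toggle j k g (Suc (Suc k)) = a"
    by (auto simp: gt_toggle_def c'_def a_def b_def c_def)
  note w = int_wt[OF gt_toggle_in_gt[OF g k]] int_wt[OF g]
  show "int (wt n (gt_toggle j k g) k) =
      int (wt n g (Suc k)) - col_wt n g j (Suc k) + col_wt n g j k"
    using k m d split[of a] split[of b] split[of c] split[of c']
    by (simp add: w g' col_wt_def flip: a_def b_def c_def)
  show "int (wt n (gt_toggle j k g) (Suc k)) =
      int (wt n g k) - col_wt n g j k + col_wt n g j (Suc k)"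
    using k m d split[of a] split[of b] split[of c] split[of c']
    by (simp add: w g' col_wt_def flip: a_def b_def c_def)
  show "wt n (gt_toggle j k g) l = wt n g l" if "l \<noteq> k" "l \<noteq> Suc k"
    using that by (auto simp: wt_def gt_toggle_def)
qed

lemma gt_le:
  assumes "g \<in> gt n nu" "l \<le> n"
  shows "g l i \<le> (\<Sum>i<n. nu ! i)"
proof (cases "i < n")
  case True
  have "g l i \<le> g n i" using gt_mono[OF assms, of i] by simp
  also have "\<dots> = nu ! i" using assms True by (simp add: gt_def)
  also have "\<dots> \<le> (\<Sum>i<n. nu ! i)" using True by (intro member_le_sum) auto
  finally show ?thesis by simp
next
  case False
  then show ?thesis using gt_eq_0[OF assms(1), of l i] assms(2) by simp
qed

lemma col_wt_large:
  assumes "g \<in> gt n nu" "k < n" "(\<Sum>i<n. nu ! i) \<le> j"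
  shows "col_wt n g j k = 0"
proof -
  have "g k i \<le> j" "g (Suc k) i \<le> j" for i
    using gt_le[OF assms(1)] assms(2,3) by (meson less_imp_le Suc_leI order_trans)+
  then show ?thesis by (simp add: col_wt_def)
qed

text \<open>With \<open>j\<close> beyond every column the cut-off has no effect, and
  \<open>gt_toggle\<close> is the classical Bender-Knuth involution, which exchanges the numbers of
  letters \<open>k\<close> and \<open>k + 1\<close>.\<close>

lemma wt_symmetric_step:
  assumes "Suc k < n"
  shows "(\<Sum>g\<in>gt n nu. F (wt n g \<circ> transpose k (Suc k))) = (\<Sum>g\<in>gt n nu. F (wt n g))"
proof -
  define j where "j = (\<Sum>i<n. nu ! i)"
  have le: "g l i \<le> j" if "g \<in> gt n nu" "l \<le> n" for g l i
    using gt_le[OF that] by (simp add: j_def)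
  have c: "col_wt n g j l = 0" if "g \<in> gt n nu" "l < n" for g l
    using col_wt_large[OF that] by (simp add: j_def)
  have w: "wt n (gt_toggle j k g) = wt n g \<circ> transpose k (Suc k)" if "g \<in> gt n nu" for g
  proof
    fix l
    have no: "j < g (Suc k) i \<Longrightarrow> j \<le> g k i" for i
      using le[OF that, of "Suc k" i] assms by simp
    note w = wt_gt_toggle[OF that assms no]
    show "wt n (gt_toggle j k g) l = (wt n g \<circ> transpose k (Suc k)) l"
      using w c[OF that] assms by (auto simp: transpose_def)
  qed
  show ?thesis
    by (rule sum.reindex_bij_witness[where i = "gt_toggle j k" and j = "gt_toggle j k"])
      (auto simp: w gt_toggle_gt_toggle assms gt_toggle_in_gt)
qed

text \<open>Adjacent transpositions generate all permutations. This is the symmetry of Schur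
  polynomials, stated for arbitrary \<open>F\<close> because it is applied with an exponent already
  added to the weight.\<close>

lemma wt_symmetric:
  assumes "p permutes {..<n}"
  shows "(\<Sum>g\<in>gt n nu. F (wt n g \<circ> p)) = (\<Sum>g\<in>gt n nu. F (wt n g))"
proof -
  \<comment> \<open>Quantifying over \<open>F\<close> inside \<open>P\<close> makes it closed under
    composition: one factor is absorbed into the summand.\<close>
  define P where "P p \<longleftrightarrow> (\<forall>F :: _ \<Rightarrow> 'a. (\<Sum>g\<in>gt n nu. F (wt n g \<circ> p)) = (\<Sum>g\<in>gt n nu. F (wt n g)))" for p
  have comp: "P (p \<circ> q)" if "P p" "P q" for p q
    unfolding P_def
  proof
    fix F :: "_ \<Rightarrow> 'a"
    have "(\<Sum>g\<in>gt n nu. (\<lambda>w. F (w \<circ> q)) (wt n g \<circ> p)) = (\<Sum>g\<in>gt n nu. F (wt n g \<circ> q))"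
      using \<open>P p\<close>[unfolded P_def, rule_format, of "\<lambda>w. F (w \<circ> q)"] by simp
    also have "\<dots> = (\<Sum>g\<in>gt n nu. F (wt n g))"
      using \<open>P q\<close> unfolding P_def by blast
    finally show "(\<Sum>g\<in>gt n nu. F (wt n g \<circ> (p \<circ> q))) = (\<Sum>g\<in>gt n nu. F (wt n g))"
      by (simp add: o_assoc)
  qed
  have adj: "P (transpose k (Suc k))" if "Suc k < n" for k
    unfolding P_def using wt_symmetric_step[OF that] by blast
  have less: "P (transpose a (Suc (a + d)))" if "Suc (a + d) < n" for a d
    using that
  proof (induction d)
    case 0
    then show ?case using adj by simp
  next
    case (Suc d)
    \<comment> \<open>Conjugation by an adjacent transposition moves the second endpoint one place
      further.\<close>
    have eq: "transpose a (Suc (a + Suc d)) = transpose (Suc (a + d)) (Suc (Suc (a + d))) \<circ>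
        transpose a (Suc (a + d)) \<circ> transpose (Suc (a + d)) (Suc (Suc (a + d)))"
      by (auto simp: fun_eq_iff transpose_def)
    show ?case unfolding eq using Suc by (intro comp adj) auto
  qed
  have tr: "P (transpose a b)" if "a < n" "b < n" "a \<noteq> b" for a b
  proof (cases "a < b")
    case True
    then show ?thesis using less[of a "b - Suc a"] that by simp
  next
    case False
    then have "P (transpose b a)" using less[of b "a - Suc b"] that by simp
    then show ?thesis by (simp add: transpose_commute)
  qed
  have "P p"
    using assms finite_lessThan
  proof (induction rule: permutes_induct)
    case id
    show ?case by (simp add: P_def o_def)
  next
    case (swap a b p)
    then show ?case using comp tr by blast
  qed
  then show ?thesis by (simp add: P_def)
qed

section \<open>Cancellation of the violations of the lattice condition\<close>

text \<open>\<open>mu\<close> plus the letters in the columns from \<open>j\<close> on is the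
  content reached when the columns are read from the right; a violation is a place where it stops
  being weakly decreasing.\<close>

definition violation :: "nat \<Rightarrow> (nat \<Rightarrow> nat) \<Rightarrow> (nat \<Rightarrow> nat \<Rightarrow> nat) \<Rightarrow> nat \<Rightarrow> nat \<Rightarrow> bool" where
  "violation n mu g j k \<longleftrightarrow> Suc k < n \<and>
     int (mu k) + col_wt n g j k < int (mu (Suc k)) + col_wt n g j (Suc k)"

definition yamanouchi :: "nat \<Rightarrow> (nat \<Rightarrow> nat) \<Rightarrow> (nat \<Rightarrow> nat \<Rightarrow> nat) \<Rightarrow> bool" where
  "yamanouchi n mu g \<longleftrightarrow> (\<forall>j k. \<not> violation n mu g j k)"

definition viol_col :: "nat \<Rightarrow> (nat \<Rightarrow> nat) \<Rightarrow> (nat \<Rightarrow> nat \<Rightarrow> nat) \<Rightarrow> nat" where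
  "viol_col n mu g = Max {j. \<exists>k. violation n mu g j k}"

definition viol_letter :: "nat \<Rightarrow> (nat \<Rightarrow> nat) \<Rightarrow> (nat \<Rightarrow> nat \<Rightarrow> nat) \<Rightarrow> nat" where
  "viol_letter n mu g = (LEAST k. violation n mu g (viol_col n mu g) k)"

definition decr :: "nat \<Rightarrow> (nat \<Rightarrow> nat) \<Rightarrow> bool" where
  "decr n mu \<longleftrightarrow> (\<forall>k. Suc k < n \<longrightarrow> mu (Suc k) \<le> mu k)"

lemma finite_violation:
  assumes "g \<in> gt n nu" "decr n mu"
  shows "finite {j. \<exists>k. violation n mu g j k}"
proof (rule finite_subset)
  show "{j. \<exists>k. violation n mu g j k} \<subseteq> {..<(\<Sum>i<n. nu ! i)}"
  proof safe
    fix j k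
    assume *: "violation n mu g j k"
    show "j < (\<Sum>i<n. nu ! i)"
    proof (rule ccontr)
      assume "\<not> ?thesis"
      then have "(\<Sum>i<n. nu ! i) \<le> j" by simp
      from col_wt_large[OF assms(1) _ this] * assms(2) show False
        by (auto simp: violation_def decr_def dest!: spec[of _ k])
    qed
  qed
qed simp

lemma violation_viol:
  assumes "g \<in> gt n nu" "decr n mu" "\<not> yamanouchi n mu g"
  shows "violation n mu g (viol_col n mu g) (viol_letter n mu g)"
proof -
  have "{j. \<exists>k. violation n mu g j k} \<noteq> {}"
    using assms(3) by (auto simp: yamanouchi_def)
  from Max_in[OF finite_violation[OF assms(1,2)] this]
  have "\<exists>k. violation n mu g (viol_col n mu g) k" by (simp add: viol_col_def)
  then show ?thesis unfolding viol_letter_def by (rule LeastI_ex)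
qed

text \<open>The right-hand side counts the letters \<open>k\<close> in the single column
  \<open>j\<close>.\<close>

lemma col_wt_step:
  "col_wt n g j k - col_wt n g (Suc j) k =
     (\<Sum>i<n. of_bool (j < g (Suc k) i)) - (\<Sum>i<n. of_bool (j < g k i))"
proof -
  have "(\<Sum>i<n. int (f i - j)) = (\<Sum>i<n. int (f i - Suc j)) + (\<Sum>i<n. of_bool (j < f i))" for f :: "nat \<Rightarrow> nat"
    unfolding sum.distrib[symmetric] by (rule sum.cong) auto
  from this[of "g k"] this[of "g (Suc k)"] show ?thesis by (simp add: col_wt_def)
qed

text \<open>By maximality of \<open>j\<close> the columns from \<open>Suc j\<close> on are still
  balanced, so column \<open>j\<close> alone tips the balance. It holds at most one letter
  \<open>k + 1\<close>, hence exactly one and no letter \<open>k\<close>, and the deficit is exactly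
  1.\<close>

lemma viol_column:
  assumes g: "g \<in> gt n nu" and mu: "decr n mu" and bad: "\<not> yamanouchi n mu g"
  defines "j \<equiv> viol_col n mu g" and "k \<equiv> viol_letter n mu g"
  shows "Suc k < n"
    and "int (mu k) + col_wt n g j k + 1 = int (mu (Suc k)) + col_wt n g j (Suc k)"
    and "j < g (Suc k) i \<Longrightarrow> j < g k i"
    and "\<exists>i<n. g (Suc k) i \<le> j \<and> j < g (Suc (Suc k)) i"
proof -
  define a b c where "a = g (Suc (Suc k))" and "b = g k" and "c = g (Suc k)"
  have v: "violation n mu g j k"
    using violation_viol[OF g mu bad] by (simp add: j_def k_def)
  then show k: "Suc k < n" by (simp add: violation_def)
  note il = gt_toggle_interlacing[OF g k, folded a_def b_def c_def]
  have nv: "\<not> violation n mu g (Suc j) k"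
  proof
    assume "violation n mu g (Suc j) k"
    then have "Suc j \<le> viol_col n mu g"
      unfolding viol_col_def using finite_violation[OF g mu] by (intro Max_ge) auto
    then show False by (simp add: j_def)
  qed
  \<comment> \<open>\<open>Nc\<close> and \<open>Na\<close> count the letters \<open>k\<close> and
    \<open>k + 1\<close> in column \<open>j\<close>.\<close>
  define Nc where "Nc = (\<Sum>i<n. of_bool (j < c i) - of_bool (j < b i) :: int)"
  define Na where "Na = (\<Sum>i<n. of_bool (j < a i) - of_bool (j < c i) :: int)"
  have s1: "col_wt n g j k - col_wt n g (Suc j) k = Nc"
    unfolding col_wt_step Nc_def by (simp add: sum_subtractf b_def c_def)
  have s2: "col_wt n g j (Suc k) - col_wt n g (Suc j) (Suc k) = Na"
    unfolding col_wt_step Na_def by (simp add: sum_subtractf a_def c_def)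
  have pos: "0 \<le> of_bool (j < c i) - (of_bool (j < b i) :: int)" for i
    using il(2) by (auto simp: interlacing_def intro: less_le_trans)
  have Nc: "0 \<le> Nc" unfolding Nc_def by (intro sum_nonneg pos)
  \<comment> \<open>Interlacing bounds the count by a telescoping sum: a column holds a letter at
    most once.\<close>
  have "Na \<le> (\<Sum>i<n. of_bool (j < a i) - of_bool (j < a (Suc i)))"
    unfolding Na_def using il(1)
    by (intro sum_mono) (auto simp: interlacing_def intro: less_le_trans)
  also have "\<dots> = of_bool (j < a 0) - of_bool (j < a n)"
    by (rule sum_lessThan_telescope')
  finally have Na: "Na \<le> 1" by (cases "j < a 0"; cases "j < a n") simp_all
  \<comment> \<open>Comparing the columns from \<open>j\<close> on with those from
    \<open>Suc j\<close> on gives \<open>Nc < Na\<close>, which leaves only these values.\<close>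
  have *: "Nc = 0" "Na = 1"
    using v nv s1 s2 Nc Na by (auto simp: violation_def)
  show "int (mu k) + col_wt n g j k + 1 = int (mu (Suc k)) + col_wt n g j (Suc k)"
    using v nv s1 s2 * by (auto simp: violation_def)
  show "j < g (Suc k) i \<Longrightarrow> j < g k i"
  proof (cases "i < n")
    case True
    have "of_bool (j < c i) - (of_bool (j < b i) :: int) = 0"
      using *(1) True unfolding Nc_def
        sum_nonneg_eq_0_iff[of "{..<n}" "\<lambda>i. of_bool (j < c i) - (of_bool (j < b i) :: int)", OF finite_lessThan pos]
      by blast
    then show "j < g (Suc k) i \<Longrightarrow> j < g k i" by (auto simp: c_def b_def split: if_splits)
  next
    case False
    then show "j < g (Suc k) i \<Longrightarrow> j < g k i" using gt_eq_0[OF g, of "Suc k" i] k by simp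
  qed
  have "\<exists>i\<in>{..<n}. of_bool (j < a i) - (of_bool (j < c i) :: int) \<noteq> 0"
    using *(2) unfolding Na_def by (metis (no_types, lifting) sum.neutral zero_neq_one)
  then obtain i where i: "i < n" "(j < a i) \<noteq> (j < c i)"
    by fastforce
  moreover have "c i \<le> a i" using il(1) by (simp add: interlacing_def)
  ultimately show "\<exists>i<n. g (Suc k) i \<le> j \<and> j < g (Suc (Suc k)) i"
    by (auto simp: a_def c_def intro!: exI[of _ i])
qed

definition viol_toggle :: "nat \<Rightarrow> (nat \<Rightarrow> nat) \<Rightarrow> (nat \<Rightarrow> nat \<Rightarrow> nat) \<Rightarrow> (nat \<Rightarrow> nat \<Rightarrow> nat)" where
  "viol_toggle n mu g = gt_toggle (viol_col n mu g) (viol_letter n mu g) g"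

lemma violation_gt_toggle:
  assumes "g \<in> gt n nu" "Suc k < n" "j \<le> j'"
  shows "violation n mu (gt_toggle j k g) j' l = violation n mu g j' l"
  by (simp add: violation_def col_wt_gt_toggle[OF assms])

text \<open>Only columns before \<open>j\<close> change, so the violations from \<open>j\<close> on
  are the same. The maximal column and its least letter are therefore found again, and the second
  move undoes the first.\<close>

lemma viol_toggle:
  assumes g: "g \<in> gt n nu" and mu: "decr n mu" and bad: "\<not> yamanouchi n mu g"
  shows "viol_toggle n mu g \<in> gt n nu" "\<not> yamanouchi n mu (viol_toggle n mu g)"
    and "viol_toggle n mu (viol_toggle n mu g) = g"
proof -
  define j k where "j = viol_col n mu g" and "k = viol_letter n mu g"
  define g' where "g' = viol_toggle n mu g"
  have g'_eq: "g' = gt_toggle j k g" by (simp add: g'_def viol_toggle_def j_def k_def)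
  have k: "Suc k < n" using viol_column(1)[OF assms] by (simp add: k_def)
  have in_gt: "g' \<in> gt n nu" unfolding g'_eq by (rule gt_toggle_in_gt[OF g k])
  have v: "violation n mu g j k" using violation_viol[OF assms] by (simp add: j_def k_def)
  have eq: "violation n mu g' j' l = violation n mu g j' l" if "j \<le> j'" for j' l
    unfolding g'_eq using violation_gt_toggle[OF g k that] .
  have bad': "\<not> yamanouchi n mu g'"
    using v eq[of j k] by (auto simp: yamanouchi_def)
  have j': "viol_col n mu g' = j"
    unfolding viol_col_def
  proof (rule Max_eqI[OF finite_violation[OF in_gt mu]])
    show "j \<in> {j. \<exists>k. violation n mu g' j k}" using v eq[of j k] by auto
    fix y assume y: "y \<in> {j. \<exists>k. violation n mu g' j k}"
    show "y \<le> j"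
    proof (rule ccontr)
      assume "\<not> y \<le> j"
      with y eq[of y] have "y \<in> {j. \<exists>k. violation n mu g j k}" by auto
      then have "y \<le> j" unfolding j_def viol_col_def by (intro Max_ge finite_violation[OF g mu])
      with \<open>\<not> y \<le> j\<close> show False by simp
    qed
  qed
  have k': "viol_letter n mu g' = k"
    by (simp add: viol_letter_def k_def j' eq flip: j_def)
  show "viol_toggle n mu g \<in> gt n nu" "\<not> yamanouchi n mu (viol_toggle n mu g)"
    using in_gt bad' by (simp_all add: g'_def)
  have "viol_toggle n mu g' = gt_toggle j k g'"
    by (simp add: viol_toggle_def j' k')
  then show "viol_toggle n mu (viol_toggle n mu g) = g"
    using gt_toggle_gt_toggle[OF g k] by (simp add: g'_def[symmetric] g'_eq)
qed

definition rho :: "nat \<Rightarrow> nat \<Rightarrow> nat" where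
  "rho n k = n - Suc k"

text \<open>The deficit 1 is made up by \<open>rho n k = Suc (rho n (Suc k))\<close>: with
  \<open>rho\<close> added, positions \<open>k\<close> and \<open>Suc k\<close> agree as far as the
  columns from \<open>j\<close> on are concerned. The columns before \<open>j\<close> exchange their
  contents, so the whole exponent has the two positions swapped.\<close>

lemma wt_viol_toggle:
  assumes g: "g \<in> gt n nu" and mu: "decr n mu" and bad: "\<not> yamanouchi n mu g"
    and "l < n"
  defines "k \<equiv> viol_letter n mu g"
  shows "mu l + rho n l + wt n (viol_toggle n mu g) l =
    ((\<lambda>l. mu l + rho n l + wt n g l) \<circ> transpose k (Suc k)) l"
proof -
  define j where "j = viol_col n mu g"
  note vc = viol_column[OF assms(1-3), folded j_def k_def]
  have no: "j < g (Suc k) i \<Longrightarrow> j \<le> g k i" for i using vc(3)[of i] by simp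
  note w = wt_gt_toggle[OF g vc(1) no]
  have t: "viol_toggle n mu g = gt_toggle j k g" by (simp add: viol_toggle_def j_def k_def)
  have r: "rho n k = Suc (rho n (Suc k))" using vc(1) by (simp add: rho_def)
  consider "l = k" | "l = Suc k" | "l \<noteq> k" "l \<noteq> Suc k" by blast
  then have "int (mu l + rho n l + wt n (viol_toggle n mu g) l) =
    int (((\<lambda>l. mu l + rho n l + wt n g l) \<circ> transpose k (Suc k)) l)"
  proof cases
    case 1
    then show ?thesis using w(1) vc(2) r by (simp add: t)
  next
    case 2
    then show ?thesis using w(2) vc(2) r by (simp add: t)
  next
    case 3
    then show ?thesis using w(3) by (simp add: t transpose_def)
  qed
  then show ?thesis by linarith
qed

text \<open>Below row \<open>i\<close> all three levels are at most \<open>j\<close> and contribute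
  nothing. Above it nothing is truncated, and as the coefficients 2, -1, -1 add up to 0, the
  dependence on \<open>j\<close> cancels. Truncated differences thus become linear in the
  pattern.\<close>

lemma col_wt_diff:
  assumes g: "g \<in> gt n nu" and k: "Suc k < n" and i: "i < n"
    and "g (Suc k) i \<le> j" "j \<le> g (Suc (Suc k)) i" and b: "\<And>i'. i' < i \<Longrightarrow> j \<le> g k i'"
  shows "col_wt n g j k - col_wt n g j (Suc k) =
    (\<Sum>i'<i. 2 * int (g (Suc k) i') - int (g k i') - int (g (Suc (Suc k)) i'))
      - (int (g (Suc (Suc k)) i) - int j)"
proof -
  note il = gt_toggle_interlacing[OF g k]
  define t where "t i' = 2 * int (g (Suc k) i' - j) - int (g k i' - j) - int (g (Suc (Suc k)) i' - j)" for i'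
  have "col_wt n g j k - col_wt n g j (Suc k) = sum t {..<n}"
    by (simp add: t_def col_wt_def sum_subtractf sum_distrib_left[symmetric])
  also have "\<dots> = sum t {..<Suc i}"
  proof (rule sum.mono_neutral_right)
    show "\<forall>i'\<in>{..<n} - {..<Suc i}. t i' = 0"
    proof
      fix i' assume i': "i' \<in> {..<n} - {..<Suc i}"
      then obtain l where l: "i' = Suc l" "i \<le> l" by (cases i') auto
      have "g (Suc (Suc k)) i' \<le> g (Suc k) l"
        using il(1) l by (simp add: interlacing_def)
      also have "\<dots> \<le> g (Suc k) i" using interlacing_antimono[OF il(2) l(2)] .
      finally have *: "g (Suc (Suc k)) i' \<le> j" using assms(4) by simp
      moreover have "g (Suc k) i' \<le> g (Suc (Suc k)) i'" "g k i' \<le> g (Suc k) i'"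
        using il by (simp_all add: interlacing_def)
      ultimately show "t i' = 0" by (simp add: t_def)
    qed
  qed (use i in auto)
  also have "\<dots> = sum t {..<i} + t i" by simp
  also have "t i = - (int (g (Suc (Suc k)) i) - int j)"
  proof -
    have "g k i \<le> g (Suc k) i" using il by (simp add: interlacing_def)
    then show ?thesis using assms(4,5) by (simp add: t_def)
  qed
  also have "sum t {..<i} =
      (\<Sum>i'<i. 2 * int (g (Suc k) i') - int (g k i') - int (g (Suc (Suc k)) i'))"
  proof (rule sum.cong[OF refl])
    fix i' assume "i' \<in> {..<i}"
    then have "j \<le> g k i'" using b by simp
    moreover have "g k i' \<le> g (Suc k) i'" "g (Suc k) i' \<le> g (Suc (Suc k)) i'"
      using il by (simp_all add: interlacing_def)
    ultimately show "t i' = 2 * int (g (Suc k) i') - int (g k i') - int (g (Suc (Suc k)) i')"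
      by (simp add: t_def of_nat_diff)
  qed
  finally show ?thesis by simp
qed

text \<open>Along a row the defect is worst just after its letters \<open>k + 1\<close> have been read, so finitely
  many linear inequalities suffice.\<close>

lemma yamanouchi_iff:
  assumes g: "g \<in> gt n nu" and mu: "decr n mu"
  shows "yamanouchi n mu g \<longleftrightarrow> (\<forall>k i. Suc k < n \<and> i < n \<longrightarrow>
    int (mu (Suc k)) + (\<Sum>i'<Suc i. int (g (Suc (Suc k)) i') - int (g (Suc k) i'))
      \<le> int (mu k) + (\<Sum>i'<i. int (g (Suc k) i') - int (g k i')))" (is "_ \<longleftrightarrow> ?R")
proof
  assume y: "yamanouchi n mu g"
  show ?R
  proof (intro allI impI, elim conjE)
    fix k i assume k: "Suc k < n" and i: "i < n"
    note il = gt_toggle_interlacing[OF g k]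
    have "g (Suc k) i \<le> g k i'" if "i' < i" for i'
    proof -
      have "g (Suc k) i \<le> g (Suc k) (Suc i')"
        using interlacing_antimono[OF il(2)] that by simp
      also have "\<dots> \<le> g k i'" using il(2) by (simp add: interlacing_def)
      finally show ?thesis .
    qed
    moreover have "g (Suc k) i \<le> g (Suc (Suc k)) i" using il by (simp add: interlacing_def)
    \<comment> \<open>The column tested is the one where the letters \<open>k + 1\<close> of row
      \<open>i\<close> begin, so that the columns from there on contain all of them.\<close>
    ultimately have d: "col_wt n g (g (Suc k) i) k - col_wt n g (g (Suc k) i) (Suc k) =
        (\<Sum>i'<i. 2 * int (g (Suc k) i') - int (g k i') - int (g (Suc (Suc k)) i'))
          - (int (g (Suc (Suc k)) i) - int (g (Suc k) i))"
      by (intro col_wt_diff[OF g k i]) auto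
    have "\<not> violation n mu g (g (Suc k) i) k" using y by (simp add: yamanouchi_def)
    then show "int (mu (Suc k)) + (\<Sum>i'<Suc i. int (g (Suc (Suc k)) i') - int (g (Suc k) i'))
      \<le> int (mu k) + (\<Sum>i'<i. int (g (Suc k) i') - int (g k i'))"
      using d k by (simp add: violation_def sum_subtractf sum_distrib_left[symmetric])
  qed
next
  assume R: ?R
  show "yamanouchi n mu g"
  proof (rule ccontr)
    assume bad: "\<not> yamanouchi n mu g"
    define j k where "j = viol_col n mu g" and "k = viol_letter n mu g"
    note vc = viol_column[OF g mu bad, folded j_def k_def]
    \<comment> \<open>The rightmost violation has a letter \<open>k + 1\<close> in column
      \<open>j\<close>; its row is the one whose inequality fails.\<close>
    obtain i where i: "i < n" "g (Suc k) i \<le> j" "j < g (Suc (Suc k)) i"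
      using vc(4) by blast
    note k = vc(1)
    note il = gt_toggle_interlacing[OF g k]
    have "j \<le> g k i'" if "i' < i" for i'
    proof -
      have "j < g (Suc (Suc k)) i" by fact
      also have "\<dots> \<le> g (Suc (Suc k)) (Suc i')"
        using interlacing_antimono[OF il(1)] that by simp
      also have "\<dots> \<le> g (Suc k) i'" using il(1) by (simp add: interlacing_def)
      finally show ?thesis using vc(3)[of i'] by simp
    qed
    then have "col_wt n g j k - col_wt n g j (Suc k) =
        (\<Sum>i'<i. 2 * int (g (Suc k) i') - int (g k i') - int (g (Suc (Suc k)) i'))
          - (int (g (Suc (Suc k)) i) - int j)"
      using i by (intro col_wt_diff[OF g k]) auto
    moreover have "int (mu (Suc k)) + (\<Sum>i'<Suc i. int (g (Suc (Suc k)) i') - int (g (Suc k) i'))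
      \<le> int (mu k) + (\<Sum>i'<i. int (g (Suc k) i') - int (g k i'))"
      using R k i(1) by blast
    \<comment> \<open>Going left from \<open>j\<close> to \<open>g (Suc k) i\<close> can only
      enlarge the deficit, so the deficit 1 at \<open>j\<close> contradicts the inequality.\<close>
    ultimately show False
      using vc(2) i(2) by (simp add: sum_subtractf sum_distrib_left[symmetric])
  qed
qed

text \<open>The pattern on the right belongs to the tableau with letter \<open>i\<close> throughout
  row \<open>i\<close>. Row by row, all earlier sums vanish and the inequality forbids larger
  letters. It is the single survivor when the cancellation is run with \<open>mu\<close>
  zero.\<close>

lemma yamanouchi_0_iff:
  assumes nu: "nu \<in> partitions n"
  shows "g \<in> gt n nu \<and> yamanouchi n (\<lambda>_. 0) g \<longleftrightarrow>
    g = (\<lambda>k i. if i < k \<and> k \<le> n then nu ! i else 0)"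
proof
  have decr0: "decr n (\<lambda>_. 0)" by (simp add: decr_def)
  show "g = (\<lambda>k i. if i < k \<and> k \<le> n then nu ! i else 0)"
    if "g \<in> gt n nu \<and> yamanouchi n (\<lambda>_. 0) g"
  proof -
    from that have g: "g \<in> gt n nu" and y: "yamanouchi n (\<lambda>_. 0) g" by auto
    have step: "i < k \<Longrightarrow> k < n \<Longrightarrow> g (Suc k) i = g k i" for i k
    proof (induction i arbitrary: k rule: less_induct)
      case (less i)
      then obtain l where l: "k = Suc l" by (cases k) auto
      have "(\<Sum>i'<Suc i. int (g (Suc (Suc l)) i') - int (g (Suc l) i'))
          \<le> (\<Sum>i'<i. int (g (Suc l) i') - int (g l i'))"
        using y unfolding yamanouchi_iff[OF g decr0] using less.prems l by auto
      moreover have "(\<Sum>i'<i. int (g (Suc (Suc l)) i') - int (g (Suc l) i')) = 0"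
        "(\<Sum>i'<i. int (g (Suc l) i') - int (g l i')) = 0"
        using less l by (auto intro!: sum.neutral)
      ultimately have "g (Suc k) i \<le> g k i" using l by simp
      then show ?case using gt_mono[OF g, of k "Suc k" i] less.prems by simp
    qed
    have "g k i = nu ! i" if "i < k" "k \<le> n" for k i
      using that(2,1)
    proof (induction k rule: inc_induct)
      case base
      then show ?case using g by (simp add: gt_def)
    next
      case (step k)
      then show ?case using \<open>\<And>k i. i < k \<Longrightarrow> k < n \<Longrightarrow> g (Suc k) i = g k i\<close> by simp
    qed
    then show ?thesis
      using gt_eq_0[OF g] g by (fastforce simp: fun_eq_iff gt_def not_less)
  qed
  show "g \<in> gt n nu \<and> yamanouchi n (\<lambda>_. 0) g"
    if "g = (\<lambda>k i. if i < k \<and> k \<le> n then nu ! i else 0)"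
  proof -
    have nu': "nu ! Suc i \<le> nu ! i" if "Suc i < n" for i
      using nu that by (auto simp: partitions_def sorted_wrt_iff_nth_less)
    have g: "g \<in> gt n nu"
      using nu' by (auto simp: that gt_def interlacing_def)
    moreover have "yamanouchi n (\<lambda>_. 0) g"
      unfolding yamanouchi_iff[OF g decr0]
    proof (intro allI impI, elim conjE)
      fix k i assume k: "Suc k < n" and i: "i < n"
      have "(\<Sum>i'<Suc i. int (g (Suc (Suc k)) i') - int (g (Suc k) i')) =
          (\<Sum>i'<Suc i. if i' = Suc k then int (nu ! Suc k) else 0)"
        using k by (intro sum.cong) (auto simp: that)
      moreover have "(\<Sum>i'<i. int (g (Suc k) i') - int (g k i')) =
          (\<Sum>i'<i. if i' = k then int (nu ! k) else 0)"
        using k by (intro sum.cong) (auto simp: that)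
      ultimately show "int 0 + (\<Sum>i'<Suc i. int (g (Suc (Suc k)) i') - int (g (Suc k) i'))
          \<le> int 0 + (\<Sum>i'<i. int (g (Suc k) i') - int (g k i'))"
        using nu'[of k] k by (simp add: sum.delta del: sum.lessThan_Suc)
    qed
    ultimately show ?thesis ..
  qed
qed

section \<open>Alternants\<close>

text \<open>Variables are numbered from 1, like the entries of \<open>ssyt\<close>.\<close>

definition mon :: "nat \<Rightarrow> (nat \<Rightarrow> nat) \<Rightarrow> mpoly" where
  "mon n al = Poly_Mapping.single (\<Sum>k<n. Poly_Mapping.single (Suc k) (al k)) 1"

definition alternant :: "nat \<Rightarrow> (nat \<Rightarrow> nat) \<Rightarrow> mpoly" where
  "alternant n al = (\<Sum>p | p permutes {..<n}. of_int (sign p) * mon n (al \<circ> p))"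

lemma mon_mult: "mon n al * mon n be = mon n (\<lambda>k. al k + be k)"
  by (simp add: mon_def mult_single single_add sum.distrib)

lemma mon_cong: "(\<And>k. k < n \<Longrightarrow> al k = be k) \<Longrightarrow> mon n al = mon n be"
  unfolding mon_def by (rule arg_cong[where f = "\<lambda>e. Poly_Mapping.single e 1"], rule sum.cong) auto

lemma alternant_cong:
  assumes "\<And>k. k < n \<Longrightarrow> al k = be k"
  shows "alternant n al = alternant n be"
proof -
  have "mon n (al \<circ> p) = mon n (be \<circ> p)" if "p permutes {..<n}" for p
    by (rule mon_cong) (use permutes_in_image[OF that] assms in auto)
  then show ?thesis unfolding alternant_def by (intro sum.cong) auto
qed

lemma alternant_transpose:
  assumes "Suc k < n"
  shows "alternant n (al \<circ> transpose k (Suc k)) = - alternant n al"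
proof -
  have q: "transpose k (Suc k) permutes {..<n}"
    using assms by (intro permutes_swap_id) auto
  have "alternant n al = (\<Sum>p | p permutes {..<n}. of_int (sign (transpose k (Suc k) \<circ> p)) *
      mon n (al \<circ> (transpose k (Suc k) \<circ> p)))"
    unfolding alternant_def by (rule setum_permutations_compose_left[OF q])
  also have "\<dots> = (\<Sum>p | p permutes {..<n}. - (of_int (sign p) * mon n (al \<circ> transpose k (Suc k) \<circ> p)))"
  proof (rule sum.cong[OF refl])
    fix p assume "p \<in> {p. p permutes {..<n}}"
    then have "permutation p" using permutes_imp_permutation by blast
    then show "of_int (sign (transpose k (Suc k) \<circ> p)) * mon n (al \<circ> (transpose k (Suc k) \<circ> p)) =
        - (of_int (sign p) * mon n (al \<circ> transpose k (Suc k) \<circ> p))"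
      by (simp add: sign_compose permutation_swap_id sign_swap_id o_assoc)
  qed
  finally show ?thesis by (simp add: alternant_def sum_negf)
qed

lemma lookup_mon_exponent:
  "k < n \<Longrightarrow> Poly_Mapping.lookup (\<Sum>k<n. Poly_Mapping.single (Suc k) (al k)) (Suc k) = al k"
  by (simp add: lookup_sum lookup_single when_def)

text \<open>Of the rearrangements of \<open>al\<close> only \<open>al\<close> itself is decreasing.
  This lets the coefficients in a combination of alternants be read off one by one.\<close>

lemma lookup_alternant:
  assumes al: "strict_antimono_on {..<n} al" and be: "strict_antimono_on {..<n} be"
  shows "Poly_Mapping.lookup (alternant n al) (\<Sum>k<n. Poly_Mapping.single (Suc k) (be k)) =
    of_bool (\<forall>k<n. al k = be k)"
proof -
  let ?e = "\<lambda>al. \<Sum>k<n. Poly_Mapping.single (Suc k) (al k) :: nat \<Rightarrow>\<^sub>0 nat"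
  have eq_iff: "?e al = ?e be \<longleftrightarrow> (\<forall>k<n. al k = be k)" for al be
    by (metis (no_types, lifting) lessThan_iff lookup_mon_exponent sum.cong)
  have id: "p = id" if p: "p permutes {..<n}" and eq: "\<forall>k<n. al (p k) = be k" for p
  proof -
    have mono: "p i < p j" if "i < j" "j < n" for i j
    proof (rule ccontr)
      assume "\<not> p i < p j"
      moreover have "p i \<noteq> p j" using permutes_inj[OF p] that by (auto dest: injD)
      ultimately have "p j < p i" by simp
      then have "al (p i) < al (p j)"
        using al permutes_in_image[OF p] that by (auto simp: monotone_on_def)
      moreover have "be j < be i" using be that by (auto simp: monotone_on_def)
      ultimately show False using eq that by auto
    qed
    have le: "i < n \<Longrightarrow> i \<le> p i" for i
    proof (induction i)
      case (Suc i)
      then show ?case using mono[of i "Suc i"] by simp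
    qed simp
    \<comment> \<open>A permutation with \<open>i \<le> p i\<close> throughout has equality
      everywhere, since both sides have the same sum.\<close>
    have "(\<Sum>i<n. p i) = (\<Sum>i<n. i)" using sum.permute[OF p, of id] by (simp add: o_def)
    then have "\<forall>i<n. p i = i"
      using sum_mono_inv[of "\<lambda>i. i" "{..<n}" p] le by (metis finite_lessThan lessThan_iff)
    then show ?thesis
      using permutes_not_in[OF p] by (auto simp: fun_eq_iff)
  qed
  have "Poly_Mapping.lookup (alternant n al) (?e be) =
      (\<Sum>p | p permutes {..<n}. Poly_Mapping.lookup (of_int (sign p) * mon n (al \<circ> p)) (?e be))"
    by (simp add: alternant_def lookup_sum)
  also have "\<dots> = (\<Sum>p | p permutes {..<n}. if p = id then of_bool (\<forall>k<n. al k = be k) else 0)"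
  proof (rule sum.cong[OF refl])
    fix p assume "p \<in> {p. p permutes {..<n}}"
    then have p: "p permutes {..<n}" by simp
    have "Poly_Mapping.lookup (of_int (sign p) * mon n (al \<circ> p)) (?e be) =
        (if \<forall>k<n. al (p k) = be k then sign p else 0)"
      using eq_iff[of "al \<circ> p" be]
      by (simp add: mon_def mult_single lookup_single when_def flip: single_of_int)
    then show "Poly_Mapping.lookup (of_int (sign p) * mon n (al \<circ> p)) (?e be) =
        (if p = id then of_bool (\<forall>k<n. al k = be k) else 0)"
      using id[OF p] by auto
  qed
  also have "\<dots> = of_bool (\<forall>k<n. al k = be k)"
    by (simp add: finite_permutations permutes_id)
  finally show ?thesis .
qed

section \<open>The Littlewood--Richardson rule\<close>

definition gt_of_tableau :: "nat \<Rightarrow> nat list \<Rightarrow> (nat \<times> nat \<Rightarrow> nat) \<Rightarrow> nat \<Rightarrow> nat \<Rightarrow> nat" where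
  "gt_of_tableau n nu T k i = (if i < n \<and> k \<le> n then card {j. j < nu ! i \<and> T (i, j) \<le> k} else 0)"

text \<open>The entry of a cell is the first level that reaches past its column. Outside the shape
  the value is \<open>undefined\<close>, as membership in the extensional function space
  demands.\<close>

definition tableau_of_gt :: "nat list \<Rightarrow> (nat \<Rightarrow> nat \<Rightarrow> nat) \<Rightarrow> nat \<times> nat \<Rightarrow> nat" where
  "tableau_of_gt nu g = (\<lambda>(i, j)\<in>cells nu. LEAST k. j < g k i)"

lemma cells_eq: "cells nu = (SIGMA i:{..<length nu}. {..<nu ! i})"
  by (auto simp: cells_def)

lemma finite_ssyt: "finite (ssyt n nu)"
proof (rule finite_subset)
  show "ssyt n nu \<subseteq> cells nu \<rightarrow>\<^sub>E {1..n}" by (auto simp: ssyt_def)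
  show "finite (cells nu \<rightarrow>\<^sub>E {1..n})" by (intro finite_PiE) (auto simp: cells_eq)
qed

lemma ssyt_PiE: "T \<in> ssyt n nu \<Longrightarrow> T \<in> cells nu \<rightarrow>\<^sub>E {1..n}"
  by (simp add: ssyt_def)

lemma partition_nth_mono:
  assumes "nu \<in> partitions n" "i \<le> k" "k < n"
  shows "nu ! k \<le> nu ! i"
  using assms by (cases "i = k") (auto simp: partitions_def sorted_wrt_iff_nth_less)

lemma ssyt_row_mono:
  assumes "T \<in> ssyt n nu" "i < length nu" "j \<le> j'" "j' < nu ! i"
  shows "T (i, j) \<le> T (i, j')"
  using assms(3,4)
proof (induction j' rule: dec_induct)
  case (step j')
  then have "T (i, j') \<le> T (i, Suc j')"
    using assms(1,2) by (auto simp: ssyt_def cells_def)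
  then show ?case using step by simp
qed simp

text \<open>Rows increase weakly, so the cells of row \<open>i\<close> with entries at most
  \<open>k\<close> form an initial segment. Together with its counterpart
  \<open>tableau_of_gt_le_iff\<close> this shows that the maps invert each other.\<close>

lemma less_gt_of_tableau_iff:
  assumes T: "T \<in> ssyt n nu" and "length nu = n" "i < n" "k \<le> n" "j < nu ! i"
  shows "j < gt_of_tableau n nu T k i \<longleftrightarrow> T (i, j) \<le> k"
proof
  assume less: "j < gt_of_tableau n nu T k i"
  show "T (i, j) \<le> k"
  proof (rule ccontr)
    assume *: "\<not> T (i, j) \<le> k"
    have "{j. j < nu ! i \<and> T (i, j) \<le> k} \<subseteq> {..<j}"
    proof safe
      fix j' assume j': "j' < nu ! i" "T (i, j') \<le> k"
      show "j' < j"
      proof (rule ccontr)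
        assume "\<not> j' < j"
        then have "T (i, j) \<le> T (i, j')" using ssyt_row_mono[OF T, of i j j'] assms j' by simp
        with * j' show False by simp
      qed
    qed
    then have "gt_of_tableau n nu T k i \<le> card {..<j}"
      unfolding gt_of_tableau_def using card_mono[OF finite_lessThan] by simp
    with less show False by simp
  qed
next
  assume *: "T (i, j) \<le> k"
  have sub: "{..j} \<subseteq> {j. j < nu ! i \<and> T (i, j) \<le> k}"
  proof
    fix j' assume "j' \<in> {..j}"
    then show "j' \<in> {j. j < nu ! i \<and> T (i, j) \<le> k}"
      using ssyt_row_mono[OF T, of i j' j] assms * by simp
  qed
  have "card {..j} \<le> gt_of_tableau n nu T k i"
    using card_mono[OF _ sub] assms(3,4) by (simp add: gt_of_tableau_def)
  then show "j < gt_of_tableau n nu T k i" by simp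
qed

lemma gt_of_tableau_in_gt:
  assumes T: "T \<in> ssyt n nu" and nu: "nu \<in> partitions n"
  shows "gt_of_tableau n nu T \<in> gt n nu"
proof -
  have len: "length nu = n" using nu by (simp add: partitions_def)
  have rng: "T (i, j) \<in> {1..n}" if "i < n" "j < nu ! i" for i j
    using PiE_mem[OF ssyt_PiE[OF T], of "(i, j)"] that len by (simp add: cells_def)
  have "gt_of_tableau n nu T 0 i = 0" for i
    using rng[of i] by (force simp: gt_of_tableau_def)
  moreover have "gt_of_tableau n nu T n i = nu ! i" if "i < n" for i
  proof -
    have "{j. j < nu ! i \<and> T (i, j) \<le> n} = {..<nu ! i}" using rng that by auto
    then show ?thesis using that by (simp add: gt_of_tableau_def)
  qed
  moreover have "interlacing (gt_of_tableau n nu T (Suc k)) (gt_of_tableau n nu T k)" if "k < n" for k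
  proof -
    have "gt_of_tableau n nu T k i \<le> gt_of_tableau n nu T (Suc k) i" for i
      using that by (auto simp: gt_of_tableau_def intro!: card_mono)
    moreover have "gt_of_tableau n nu T (Suc k) (Suc i) \<le> gt_of_tableau n nu T k i" for i
    proof (cases "Suc i < n")
      case True
      \<comment> \<open>Column strictness: above an entry that is at most \<open>Suc k\<close>
        stands one that is at most \<open>k\<close>.\<close>
      have "{j. j < nu ! Suc i \<and> T (Suc i, j) \<le> Suc k} \<subseteq> {j. j < nu ! i \<and> T (i, j) \<le> k}"
      proof safe
        fix j assume j: "j < nu ! Suc i" "T (Suc i, j) \<le> Suc k"
        show "j < nu ! i" using partition_nth_mono[OF nu, of i "Suc i"] True j by simp
        then have "T (i, j) < T (Suc i, j)"
          using T True j len by (auto simp: ssyt_def cells_def)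
        then show "T (i, j) \<le> k" using j by simp
      qed
      then show ?thesis using True that by (auto simp: gt_of_tableau_def intro!: card_mono)
    qed (simp add: gt_of_tableau_def)
    ultimately show ?thesis by (simp add: interlacing_def)
  qed
  ultimately show ?thesis by (auto simp: gt_def gt_of_tableau_def)
qed

lemma tableau_of_gt_le_iff:
  assumes g: "g \<in> gt n nu" and "length nu = n" "i < n" "j < nu ! i" "k \<le> n"
  shows "tableau_of_gt nu g (i, j) \<le> k \<longleftrightarrow> j < g k i"
proof -
  have T: "tableau_of_gt nu g (i, j) = (LEAST k. j < g k i)"
    using assms by (simp add: tableau_of_gt_def cells_def)
  have "j < g n i" using assms by (simp add: gt_def)
  then have L: "j < g (LEAST k. j < g k i) i" by (rule LeastI)
  show ?thesis
  proof
    assume "tableau_of_gt nu g (i, j) \<le> k"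
    then have "g (LEAST k. j < g k i) i \<le> g k i" using T gt_mono[OF g] assms by simp
    with L show "j < g k i" by simp
  next
    assume "j < g k i"
    then show "tableau_of_gt nu g (i, j) \<le> k" unfolding T by (rule Least_le)
  qed
qed

lemma tableau_of_gt_in_ssyt:
  assumes g: "g \<in> gt n nu" and nu: "nu \<in> partitions n"
  shows "tableau_of_gt nu g \<in> ssyt n nu"
proof -
  have len: "length nu = n" using nu by (simp add: partitions_def)
  note le_iff = tableau_of_gt_le_iff[OF g len]
  have rng: "1 \<le> tableau_of_gt nu g (i, j) \<and> tableau_of_gt nu g (i, j) \<le> n"
    if "i < n" "j < nu ! i" for i j
    using le_iff[OF that, of 0] le_iff[OF that, of n] that g by (auto simp: gt_def)
  have row: "tableau_of_gt nu g (i, j) \<le> tableau_of_gt nu g (i, Suc j)" if "i < n" "Suc j < nu ! i" for i j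
    using le_iff[OF that(1), of "Suc j" "tableau_of_gt nu g (i, Suc j)"]
      le_iff[OF that(1), of j "tableau_of_gt nu g (i, Suc j)"] rng[of i "Suc j"] that by auto
  have col: "tableau_of_gt nu g (i, j) < tableau_of_gt nu g (Suc i, j)"
    if "Suc i < n" "j < nu ! Suc i" for i j
  proof -
    obtain k where k: "tableau_of_gt nu g (Suc i, j) = Suc k"
      using rng[OF \<open>Suc i < n\<close> \<open>j < nu ! Suc i\<close>] by (cases "tableau_of_gt nu g (Suc i, j)") auto
    have j: "j < nu ! i" using that partition_nth_mono[OF nu, of i "Suc i"] by simp
    have "k < n" using rng[OF that] k by simp
    have "j < g (Suc k) (Suc i)" using le_iff[OF that, of "Suc k"] k \<open>k < n\<close> by simp
    also have "\<dots> \<le> g k i" using gt_interlacing[OF g \<open>k < n\<close>] by (simp add: interlacing_def)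
    finally have "tableau_of_gt nu g (i, j) \<le> k" using le_iff[of i j k] j that \<open>k < n\<close> by simp
    then show ?thesis using k by simp
  qed
  have "tableau_of_gt nu g \<in> cells nu \<rightarrow>\<^sub>E {1..n}"
  proof (rule PiE_I)
    fix c assume "c \<in> cells nu"
    then show "tableau_of_gt nu g c \<in> {1..n}"
      using rng[of "fst c" "snd c"] len by (cases c) (auto simp: cells_def)
  qed (simp add: tableau_of_gt_def)
  then show ?thesis
    unfolding ssyt_def mem_Collect_eq
  proof (intro conjI allI impI)
    fix i j assume "(i, j) \<in> cells nu \<and> (i, Suc j) \<in> cells nu"
    then show "tableau_of_gt nu g (i, j) \<le> tableau_of_gt nu g (i, Suc j)"
      using row[of i j] len by (simp add: cells_def)
  next
    fix i j assume "(i, j) \<in> cells nu \<and> (Suc i, j) \<in> cells nu"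
    then show "tableau_of_gt nu g (i, j) < tableau_of_gt nu g (Suc i, j)"
      using col[of i j] len by (simp add: cells_def)
  qed
qed

lemma tableau_of_gt_of_tableau:
  assumes T: "T \<in> ssyt n nu" and nu: "nu \<in> partitions n"
  shows "tableau_of_gt nu (gt_of_tableau n nu T) = T"
proof
  fix c :: "nat \<times> nat"
  have len: "length nu = n" using nu by (simp add: partitions_def)
  obtain i j where c: "c = (i, j)" by (cases c)
  show "tableau_of_gt nu (gt_of_tableau n nu T) c = T c"
  proof (cases "c \<in> cells nu")
    case True
    then have ij: "i < n" "j < nu ! i" using c len by (auto simp: cells_def)
    have iff: "tableau_of_gt nu (gt_of_tableau n nu T) c \<le> k \<longleftrightarrow> T c \<le> k" if "k \<le> n" for k
      using tableau_of_gt_le_iff[OF gt_of_tableau_in_gt[OF T nu] len ij that]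
        less_gt_of_tableau_iff[OF T len ij(1) that ij(2)] c by simp
    have "T c \<le> n" using PiE_mem[OF ssyt_PiE[OF T] True] by simp
    from iff[OF this] have le: "tableau_of_gt nu (gt_of_tableau n nu T) c \<le> T c" by (rule iffD2) simp
    then have "tableau_of_gt nu (gt_of_tableau n nu T) c \<le> n" using \<open>T c \<le> n\<close> by (rule order_trans)
    from iff[OF this] have "T c \<le> tableau_of_gt nu (gt_of_tableau n nu T) c" by (rule iffD1) simp
    with le show ?thesis by (rule antisym)
  next
    case False
    then show ?thesis using PiE_arb[OF ssyt_PiE[OF T]] by (simp add: tableau_of_gt_def)
  qed
qed

lemma gt_of_tableau_of_gt:
  assumes g: "g \<in> gt n nu" and nu: "nu \<in> partitions n"
  shows "gt_of_tableau n nu (tableau_of_gt nu g) = g"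
proof (intro ext)
  fix k i
  have len: "length nu = n" using nu by (simp add: partitions_def)
  show "gt_of_tableau n nu (tableau_of_gt nu g) k i = g k i"
  proof (cases "i < n \<and> k \<le> n")
    case True
    have "g k i \<le> g n i" using gt_mono[OF g] True by simp
    also have "\<dots> = nu ! i" using g True by (simp add: gt_def)
    finally have "{j. j < nu ! i \<and> tableau_of_gt nu g (i, j) \<le> k} = {..<g k i}"
      using tableau_of_gt_le_iff[OF g len] True by auto
    then show ?thesis using True by (simp add: gt_of_tableau_def)
  next
    case False
    then show ?thesis using g by (auto simp: gt_of_tableau_def gt_def)
  qed
qed

lemma finite_gt:
  assumes "nu \<in> partitions n"
  shows "finite (gt n nu)"
proof (rule finite_surj[OF finite_ssyt])
  show "gt n nu \<subseteq> gt_of_tableau n nu ` ssyt n nu"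
    using gt_of_tableau_of_gt[OF _ assms] tableau_of_gt_in_ssyt[OF _ assms] by (metis image_iff subsetI)
qed

lemma prod_X:
  "finite A \<Longrightarrow> (\<Prod>c\<in>A. X (T c)) = Poly_Mapping.single (\<Sum>c\<in>A. Poly_Mapping.single (T c) 1) 1"
  by (induction A rule: finite_induct) (auto simp: X_def mult_single)

lemma prod_X_tableau:
  assumes T: "T \<in> ssyt n nu" and nu: "nu \<in> partitions n"
  shows "(\<Prod>c\<in>cells nu. X (T c)) = mon n (wt n (gt_of_tableau n nu T))"
proof -
  have len: "length nu = n" using nu by (simp add: partitions_def)
  have rng: "T (i, j) \<in> {1..n}" if "i < n" "j < nu ! i" for i j
    using PiE_mem[OF ssyt_PiE[OF T], of "(i, j)"] that len by (simp add: cells_def)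
  have fin: "finite (cells nu)" by (simp add: cells_eq)
  have "(\<Sum>c\<in>cells nu. Poly_Mapping.single (T c) (1::nat)) =
      (\<Sum>k<n. Poly_Mapping.single (Suc k) (wt n (gt_of_tableau n nu T) k))" (is "?l = ?r")
  proof (rule poly_mapping_eqI)
    fix m
    have "Poly_Mapping.lookup ?l m = (\<Sum>c\<in>cells nu. of_bool (T c = m))"
      unfolding lookup_sum
      by (intro sum.cong) (auto simp: lookup_single when_def)
    also have "\<dots> = (\<Sum>i<n. \<Sum>j<nu ! i. of_bool (T (i, j) = m))"
      unfolding cells_eq len by (subst sum.Sigma) (simp_all add: case_prod_unfold)
    also have "\<dots> = (\<Sum>i<n. card {j. j < nu ! i \<and> T (i, j) = m})"
      by (intro sum.cong) (auto simp: Int_def)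
    also have "\<dots> = Poly_Mapping.lookup ?r m"
    proof (cases "\<exists>k<n. m = Suc k")
      case True
      then obtain k where k: "k < n" "m = Suc k" by blast
      have "card {j. j < nu ! i \<and> T (i, j) = m} =
          gt_of_tableau n nu T (Suc k) i - gt_of_tableau n nu T k i" if "i < n" for i
      proof -
        have eq: "{j. j < nu ! i \<and> T (i, j) = m} =
            {j. j < nu ! i \<and> T (i, j) \<le> Suc k} - {j. j < nu ! i \<and> T (i, j) \<le> k}"
          using k by auto
        have row: "gt_of_tableau n nu T (Suc k) i = card {j. j < nu ! i \<and> T (i, j) \<le> Suc k}"
          "gt_of_tableau n nu T k i = card {j. j < nu ! i \<and> T (i, j) \<le> k}"
          using k(1) that by (simp_all add: gt_of_tableau_def)
        show ?thesis unfolding eq row by (rule card_Diff_subset) auto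
      qed
      then have "(\<Sum>i<n. card {j. j < nu ! i \<and> T (i, j) = m}) = wt n (gt_of_tableau n nu T) k"
        by (simp add: wt_def)
      then show ?thesis using k by (simp add: lookup_mon_exponent)
    next
      case False
      have "{j. j < nu ! i \<and> T (i, j) = m} = {}" if "i < n" for i
      proof -
        have "m \<notin> {1..n}"
          using False by (cases m) auto
        then show ?thesis using rng[OF that] by blast
      qed
      then have "(\<Sum>i<n. card {j. j < nu ! i \<and> T (i, j) = m}) = 0" by simp
      also have "\<dots> = Poly_Mapping.lookup ?r m"
        using False by (auto simp: lookup_sum lookup_single when_def intro!: sum.neutral[symmetric])
      finally show ?thesis .
    qed
    finally show "Poly_Mapping.lookup ?l m = Poly_Mapping.lookup ?r m" .
  qed
  then show ?thesis by (simp add: prod_X[OF fin] mon_def)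
qed

section \<open>Products of alternants with Schur polynomials\<close>

lemma schur_gt:
  assumes nu: "nu \<in> partitions n"
  shows "schur n nu = (\<Sum>g\<in>gt n nu. mon n (wt n g))"
  unfolding schur_def
  by (rule sum.reindex_bij_witness[where i = "tableau_of_gt nu" and j = "gt_of_tableau n nu"])
    (use nu in \<open>auto simp: tableau_of_gt_of_tableau gt_of_tableau_of_gt gt_of_tableau_in_gt
      tableau_of_gt_in_ssyt prod_X_tableau\<close>)

text \<open>By symmetry the weights in the term of \<open>p\<close> may be replaced by
  \<open>wt n g \<circ> p\<close>; then \<open>p\<close> acts on the whole exponent
  \<open>al + wt n g\<close>.\<close>

lemma alternant_mult_schur:
  assumes nu: "nu \<in> partitions n"
  shows "alternant n al * schur n nu = (\<Sum>g\<in>gt n nu. alternant n (\<lambda>k. al k + wt n g k))"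
proof -
  have "alternant n al * schur n nu =
      (\<Sum>p | p permutes {..<n}. of_int (sign p) * (\<Sum>g\<in>gt n nu. mon n (\<lambda>k. (al \<circ> p) k + wt n g k)))"
    unfolding alternant_def schur_gt[OF nu] sum_distrib_right
    by (intro sum.cong refl) (simp add: mult.assoc sum_distrib_left mon_mult)
  also have "\<dots> = (\<Sum>p | p permutes {..<n}. of_int (sign p) *
      (\<Sum>g\<in>gt n nu. mon n ((\<lambda>k. al k + wt n g k) \<circ> p)))"
  proof (rule sum.cong[OF refl])
    fix p assume "p \<in> {p. p permutes {..<n}}"
    then have p: "p permutes {..<n}" by simp
    show "of_int (sign p) * (\<Sum>g\<in>gt n nu. mon n (\<lambda>k. (al \<circ> p) k + wt n g k)) =
        of_int (sign p) * (\<Sum>g\<in>gt n nu. mon n ((\<lambda>k. al k + wt n g k) \<circ> p))"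
      using wt_symmetric[OF p, of "\<lambda>w. mon n (\<lambda>k. (al \<circ> p) k + w k)" nu] by (simp add: o_def)
  qed
  also have "\<dots> = (\<Sum>g\<in>gt n nu. alternant n (\<lambda>k. al k + wt n g k))"
    unfolding alternant_def sum_distrib_left by (rule sum.swap)
  finally show ?thesis .
qed

text \<open>The move swaps two neighbouring entries of the exponent and so negates the alternant;
  the violating patterns contribute a sum equal to its own negative.\<close>

lemma alternant_mult_schur_yamanouchi:
  assumes nu: "nu \<in> partitions n" and mu: "decr n mu"
  shows "alternant n (\<lambda>k. mu k + rho n k) * schur n nu =
    (\<Sum>g | g \<in> gt n nu \<and> yamanouchi n mu g. alternant n (\<lambda>k. mu k + rho n k + wt n g k))"
proof -
  let ?A = "\<lambda>g. alternant n (\<lambda>k. mu k + rho n k + wt n g k)"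
  let ?B = "{g \<in> gt n nu. \<not> yamanouchi n mu g}"
  have neg: "?A (viol_toggle n mu g) = - ?A g" if "g \<in> ?B" for g
  proof -
    have g: "g \<in> gt n nu" "\<not> yamanouchi n mu g" using that by auto
    have "?A (viol_toggle n mu g) = alternant n ((\<lambda>k. mu k + rho n k + wt n g k) \<circ>
        transpose (viol_letter n mu g) (Suc (viol_letter n mu g)))"
      by (rule alternant_cong) (rule wt_viol_toggle[OF g(1) mu g(2)])
    also have "\<dots> = - ?A g"
      by (rule alternant_transpose) (rule viol_column(1)[OF g(1) mu g(2)])
    finally show ?thesis .
  qed
  have "sum ?A ?B = (\<Sum>g\<in>?B. - ?A g)"
    by (rule sum.reindex_bij_witness[where i = "viol_toggle n mu" and j = "viol_toggle n mu"])
      (use viol_toggle mu neg in auto)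
  then have "2 * sum ?A ?B = 0" by (simp add: sum_negf)
  then have B: "sum ?A ?B = 0" by simp
  have "gt n nu = {g. g \<in> gt n nu \<and> yamanouchi n mu g} \<union> ?B" by auto
  then have "sum ?A (gt n nu) = sum ?A ({g. g \<in> gt n nu \<and> yamanouchi n mu g} \<union> ?B)" by simp
  also have "\<dots> = (\<Sum>g | g \<in> gt n nu \<and> yamanouchi n mu g. ?A g) + sum ?A ?B"
    using finite_gt[OF nu] by (intro sum.union_disjoint) auto
  finally show ?thesis using B by (simp add: alternant_mult_schur[OF nu])
qed

text \<open>The bialternant formula, obtained from the cancellation with \<open>mu\<close> zero: the
  only surviving pattern has weight \<open>nu\<close>.\<close>

lemma alternant_rho_mult_schur:
  assumes nu: "nu \<in> partitions n"
  shows "alternant n (rho n) * schur n nu = alternant n (\<lambda>k. nu ! k + rho n k)"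
proof -
  define g where "g = (\<lambda>k i. if i < k \<and> k \<le> n then nu ! i else 0)"
  have "alternant n (\<lambda>k. 0 + rho n k) * schur n nu =
      (\<Sum>g | g \<in> gt n nu \<and> yamanouchi n (\<lambda>_. 0) g. alternant n (\<lambda>k. 0 + rho n k + wt n g k))"
    by (rule alternant_mult_schur_yamanouchi[OF nu]) (simp add: decr_def)
  also have "{g. g \<in> gt n nu \<and> yamanouchi n (\<lambda>_. 0) g} = {g}"
    using yamanouchi_0_iff[OF nu] unfolding g_def by blast
  also have "(\<Sum>g\<in>{g}. alternant n (\<lambda>k. 0 + rho n k + wt n g k)) = alternant n (\<lambda>k. nu ! k + rho n k)"
  proof -
    have "wt n g k = nu ! k" if "k < n" for k
    proof -
      have "wt n g k = (\<Sum>i<n. if i = k then nu ! k else 0)"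
        unfolding wt_def g_def using that by (intro sum.cong) auto
      then show ?thesis using that by simp
    qed
    then show ?thesis by (auto intro!: alternant_cong)
  qed
  finally show ?thesis by simp
qed

lemma strict_antimono_add_rho:
  assumes "decr n mu"
  shows "strict_antimono_on {..<n} (\<lambda>k. mu k + rho n k)"
proof -
  have "mu j \<le> mu i" if "i \<le> j" "j < n" for i j
    using that
  proof (induction j rule: dec_induct)
    case (step j)
    then show ?case using assms by (auto simp: decr_def intro: order_trans)
  qed simp
  moreover have "rho n j < rho n i" if "i < j" "j < n" for i j
    using that unfolding rho_def by linarith
  ultimately show ?thesis
    by (intro monotone_onI) (auto intro!: add_le_less_mono)
qed

lemma decr_nth: "mu \<in> partitions n \<Longrightarrow> decr n ((!) mu)"
  using partition_nth_mono by (auto simp: decr_def)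

text \<open>The \<open>rho\<close> alternant turns each Schur polynomial into an alternant, whose
  decreasing monomial identifies the partition. This is the linear independence behind the
  uniqueness of the expansion.\<close>

lemma lookup_alternant_rho_mult_sum_schur:
  assumes "finite S" "S \<subseteq> partitions n" "lam \<in> partitions n"
  shows "Poly_Mapping.lookup (alternant n (rho n) * (\<Sum>la\<in>S. of_nat (c la) * schur n la))
    (\<Sum>k<n. Poly_Mapping.single (Suc k) (lam ! k + rho n k)) = (if lam \<in> S then int (c lam) else 0)"
proof -
  have "alternant n (rho n) * (\<Sum>la\<in>S. of_nat (c la) * schur n la) =
      (\<Sum>la\<in>S. of_nat (c la) * (alternant n (rho n) * schur n la))"
    by (simp add: sum_distrib_left mult.left_commute)
  also have "\<dots> = (\<Sum>la\<in>S. of_nat (c la) * alternant n (\<lambda>k. la ! k + rho n k))"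
    using assms alternant_rho_mult_schur by (intro sum.cong) auto
  also have "Poly_Mapping.lookup \<dots> (\<Sum>k<n. Poly_Mapping.single (Suc k) (lam ! k + rho n k)) =
      (\<Sum>la\<in>S. int (c la) * of_bool (la = lam))"
    unfolding lookup_sum
  proof (rule sum.cong[OF refl])
    fix la assume "la \<in> S"
    then have la: "la \<in> partitions n" using assms by blast
    have eq: "(\<forall>k<n. la ! k + rho n k = lam ! k + rho n k) \<longleftrightarrow> la = lam"
      using la assms(3) by (auto simp: partitions_def intro: nth_equalityI)
    have nat_mult: "Poly_Mapping.lookup (of_nat m * p) e = int m * Poly_Mapping.lookup p e" for m e and p :: mpoly
      by (induction m) (auto simp: lookup_add algebra_simps)
    show "Poly_Mapping.lookup (of_nat (c la) * alternant n (\<lambda>k. la ! k + rho n k))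
        (\<Sum>k<n. Poly_Mapping.single (Suc k) (lam ! k + rho n k)) = int (c la) * of_bool (la = lam)"
      unfolding nat_mult
      using lookup_alternant[OF strict_antimono_add_rho[OF decr_nth[OF la]]
          strict_antimono_add_rho[OF decr_nth[OF assms(3)]]] eq by simp
  qed
  also have "\<dots> = (if lam \<in> S then int (c lam) else 0)"
    using assms(1) by (simp add: of_bool_def if_distrib cong: if_cong)
  finally show ?thesis .
qed

lemma alternant_rho_nonzero: "alternant n (rho n) \<noteq> 0"
proof
  assume "alternant n (rho n) = 0"
  moreover have "strict_antimono_on {..<n} (rho n)"
    using strict_antimono_add_rho[of n "\<lambda>_. 0"] by (simp add: decr_def)
  ultimately show False using lookup_alternant[of n "rho n" "rho n"] by simp
qed

section \<open>The coefficient as a number of patterns\<close>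

definition lr_patterns :: "nat \<Rightarrow> nat list \<Rightarrow> nat list \<Rightarrow> nat list \<Rightarrow> (nat \<Rightarrow> nat \<Rightarrow> nat) set" where
  "lr_patterns n mu nu lam =
     {g \<in> gt n nu. yamanouchi n ((!) mu) g \<and> (\<forall>k<n. mu ! k + wt n g k = lam ! k)}"

theorem lr_coeff_eq_card:
  assumes mu: "mu \<in> partitions n" and nu: "nu \<in> partitions n" and lam: "lam \<in> partitions n"
  shows "lr_coeff n mu nu lam = card (lr_patterns n mu nu lam)"
proof -
  let ?G = "{g. g \<in> gt n nu \<and> yamanouchi n ((!) mu) g}"
  define w where "w g = map (\<lambda>k. mu ! k + wt n g k) [0..<n]" for g
  define c where "c la = (if la \<in> partitions n then card (lr_patterns n mu nu la) else 0)" for la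
  have fin: "finite ?G" using finite_gt[OF nu] by simp
  have w_part: "w g \<in> partitions n" if "g \<in> ?G" for g
  proof -
    \<comment> \<open>At column 0 the lattice condition concerns the full weight and says that
      \<open>mu\<close> plus the weight is again a partition.\<close>
    have "mu ! Suc k + wt n g (Suc k) \<le> mu ! k + wt n g k" if "Suc k < n" for k
    proof -
      have "\<not> violation n ((!) mu) g 0 k" using \<open>g \<in> ?G\<close> by (simp add: yamanouchi_def)
      then have "int (mu ! Suc k + wt n g (Suc k)) \<le> int (mu ! k + wt n g k)"
        using that \<open>g \<in> ?G\<close> by (simp add: violation_def col_wt_0[of g n nu])
      then show ?thesis by linarith
    qed
    then show ?thesis
      by (auto simp: partitions_def w_def sorted_wrt_iff_nth_Suc_transp transp_def)
  qed
  have patt: "lr_patterns n mu nu la = {g \<in> ?G. w g = la}" if "la \<in> partitions n" for la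
    using that by (auto simp: lr_patterns_def w_def partitions_def list_eq_iff_nth_eq)
  have supp: "{la. c la \<noteq> 0} \<subseteq> w ` ?G"
  proof
    fix la assume "la \<in> {la. c la \<noteq> 0}"
    then have "la \<in> partitions n" "lr_patterns n mu nu la \<noteq> {}" by (auto simp: c_def split: if_splits)
    then show "la \<in> w ` ?G" using patt by auto
  qed
  have "alternant n (rho n) * (schur n mu * schur n nu) =
      alternant n (\<lambda>k. mu ! k + rho n k) * schur n nu"
    by (simp add: alternant_rho_mult_schur[OF mu] flip: mult.assoc)
  also have "\<dots> = (\<Sum>g\<in>?G. alternant n (\<lambda>k. mu ! k + rho n k + wt n g k))"
    by (rule alternant_mult_schur_yamanouchi[OF nu decr_nth[OF mu]])
  also have "\<dots> = (\<Sum>g\<in>?G. alternant n (rho n) * schur n (w g))"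
  proof (rule sum.cong[OF refl])
    fix g assume "g \<in> ?G"
    have "alternant n (rho n) * schur n (w g) = alternant n (\<lambda>k. w g ! k + rho n k)"
      by (rule alternant_rho_mult_schur[OF w_part[OF \<open>g \<in> ?G\<close>]])
    also have "\<dots> = alternant n (\<lambda>k. mu ! k + rho n k + wt n g k)"
      by (rule alternant_cong) (simp add: w_def)
    finally show "alternant n (\<lambda>k. mu ! k + rho n k + wt n g k) = alternant n (rho n) * schur n (w g)"
      by simp
  qed
  also have "\<dots> = alternant n (rho n) * (\<Sum>g\<in>?G. schur n (w g))"
    by (simp add: sum_distrib_left)
  finally have "schur n mu * schur n nu = (\<Sum>g\<in>?G. schur n (w g))"
    using alternant_rho_nonzero by simp
  also have "\<dots> = (\<Sum>la\<in>w ` ?G. \<Sum>g | g \<in> ?G \<and> w g = la. schur n (w g))"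
    by (rule sum.image_gen[OF fin])
  also have "\<dots> = (\<Sum>la\<in>w ` ?G. of_nat (c la) * schur n la)"
    using patt w_part by (intro sum.cong) (auto simp: c_def)
  also have "\<dots> = (\<Sum>la | c la \<noteq> 0. of_nat (c la) * schur n la)"
    using fin supp by (intro sum.mono_neutral_right) auto
  finally have expansion: "schur n mu * schur n nu = (\<Sum>la | c la \<noteq> 0. of_nat (c la) * schur n la)" .
  have c_props: "finite {la. c la \<noteq> 0} \<and> {la. c la \<noteq> 0} \<subseteq> partitions n"
    using finite_subset[OF supp] fin by (auto simp: c_def split: if_splits)
  have "lr_coeff n mu nu = c"
    unfolding lr_coeff_def
  proof (rule the_equality)
    show "finite {la. c la \<noteq> 0} \<and> {la. c la \<noteq> 0} \<subseteq> partitions n \<and>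
        schur n mu * schur n nu = (\<Sum>la | c la \<noteq> 0. of_nat (c la) * schur n la)"
      using c_props expansion by blast
  next
    fix c' assume c': "finite {la. c' la \<noteq> 0} \<and> {la. c' la \<noteq> 0} \<subseteq> partitions n \<and>
        schur n mu * schur n nu = (\<Sum>la | c' la \<noteq> 0. of_nat (c' la) * schur n la)"
    \<comment> \<open>Inside \<open>partitions n\<close> both expansions are compared after
      multiplication by the \<open>rho\<close> alternant; outside, both functions vanish.\<close>
    show "c' = c"
    proof
      fix la
      show "c' la = c la"
      proof (cases "la \<in> partitions n")
        case True
        have "(if la \<in> {la. c' la \<noteq> 0} then int (c' la) else 0) =
            (if la \<in> {la. c la \<noteq> 0} then int (c la) else 0)"
          using lookup_alternant_rho_mult_sum_schur[OF _ _ True, of "{la. c' la \<noteq> 0}" c']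
            lookup_alternant_rho_mult_sum_schur[OF _ _ True, of "{la. c la \<noteq> 0}" c]
            c' c_props expansion by simp
        then show ?thesis by (simp split: if_splits)
      next
        case False
        then have "la \<notin> {la. c' la \<noteq> 0}" "la \<notin> {la. c la \<noteq> 0}" using c' c_props by blast+
        then show ?thesis by simp
      qed
    qed
  qed
  then show ?thesis using lam by (simp add: c_def)
qed

section \<open>Counting accepting paths\<close>

fun fits :: "nat \<Rightarrow> config \<Rightarrow> bool" where
  "fits b (q, i, ts) \<longleftrightarrow> (\<forall>(t, h)\<in>set ts. h < b)"

text \<open>\<open>runs M x b c k\<close>: from \<open>c\<close> every computation path halts and stays within space \<open>b\<close>, and
  exactly \<open>k\<close> of them accept.\<close>

inductive runs :: "machine \<Rightarrow> bool list \<Rightarrow> nat \<Rightarrow> config \<Rightarrow> nat \<Rightarrow> bool" for M x b where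
  runs_halt: "fits b c \<Longrightarrow> enabled M x c = {} \<Longrightarrow> runs M x b c (of_bool (fst c \<in> accept M))"
| runs_step: "fits b c \<Longrightarrow> finite (enabled M x c) \<Longrightarrow> enabled M x c \<noteq> {} \<Longrightarrow>
    (\<And>a. a \<in> enabled M x c \<Longrightarrow> runs M x b (perform x a c) (k a)) \<Longrightarrow>
    runs M x b c (\<Sum>a\<in>enabled M x c. k a)"

lemma runs_det:
  assumes "fits b c" "enabled M x c = {a}" "runs M x b (perform x a c) k"
  shows "runs M x b c k"
  using runs_step[of b c M x "\<lambda>_. k"] assms by simp

text \<open>\<open>accepting_paths\<close> from an arbitrary configuration, as induction over
  \<open>runs\<close> requires.\<close>

definition accepting_from :: "machine \<Rightarrow> bool list \<Rightarrow> config \<Rightarrow> action list set" where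
  "accepting_from M x c = {as. \<exists>c'. path M x c as c' \<and> enabled M x c' = {} \<and> fst c' \<in> accept M}"

lemma path_Nil_iff: "path M x c [] c' \<longleftrightarrow> c' = c"
  by (auto elim: path.cases intro: path_Nil)

lemma path_Cons_iff: "path M x c (a # as) c' \<longleftrightarrow> a \<in> enabled M x c \<and> path M x (perform x a c) as c'"
  by (auto elim: path.cases intro: path_Cons)

lemma accepting_from_Nil:
  "[] \<in> accepting_from M x c \<longleftrightarrow> enabled M x c = {} \<and> fst c \<in> accept M"
  by (auto simp: accepting_from_def path_Nil_iff simp del: split_paired_Ex)

lemma accepting_from_Cons:
  "a # as \<in> accepting_from M x c \<longleftrightarrow>
    a \<in> enabled M x c \<and> as \<in> accepting_from M x (perform x a c)"
  by (auto simp: accepting_from_def path_Cons_iff simp del: split_paired_Ex)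

text \<open>Paths are lists of transitions, so those from a non-halting configuration split
  disjointly by their first entry.\<close>

lemma runs_card: "runs M x b c k \<Longrightarrow> finite (accepting_from M x c) \<and> card (accepting_from M x c) = k"
proof (induction rule: runs.induct)
  case (runs_halt c)
  have "accepting_from M x c = (if fst c \<in> accept M then {[]} else {})"
  proof (rule set_eqI)
    fix as
    show "as \<in> accepting_from M x c \<longleftrightarrow> as \<in> (if fst c \<in> accept M then {[]} else {})"
      using runs_halt by (cases as) (auto simp: accepting_from_Nil accepting_from_Cons)
  qed
  then show ?case by simp
next
  case (runs_step c k)
  have eq: "accepting_from M x c = (\<Union>a\<in>enabled M x c. (#) a ` accepting_from M x (perform x a c))"
  proof (rule set_eqI)
    fix as
    show "as \<in> accepting_from M x c \<longleftrightarrow>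
        as \<in> (\<Union>a\<in>enabled M x c. (#) a ` accepting_from M x (perform x a c))"
      using runs_step(3) by (cases as) (auto simp: accepting_from_Nil accepting_from_Cons)
  qed
  have "card (accepting_from M x c) =
      (\<Sum>a\<in>enabled M x c. card ((#) a ` accepting_from M x (perform x a c)))"
    unfolding eq by (rule card_UN_disjoint) (use runs_step in auto)
  also have "\<dots> = (\<Sum>a\<in>enabled M x c. k a)"
    by (rule sum.cong) (use runs_step in \<open>auto simp: card_image\<close>)
  finally show ?case using eq runs_step by auto
qed

lemma runs_fits: "runs M x b c k \<Longrightarrow> path M x c as c' \<Longrightarrow> fits b c'"
proof (induction arbitrary: as rule: runs.induct)
  case (runs_halt c)
  then show ?case by (cases as) (auto simp: path_Nil_iff path_Cons_iff)
next
  case (runs_step c k)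
  then show ?case by (cases as) (auto simp: path_Nil_iff path_Cons_iff)
qed

lemma runs_halts:
  "runs M x b c k \<Longrightarrow> cs 0 = c \<Longrightarrow> \<exists>k. \<forall>a\<in>enabled M x (cs k). cs (Suc k) \<noteq> perform x a (cs k)"
proof (induction arbitrary: cs rule: runs.induct)
  case (runs_halt c)
  then show ?case by (auto intro: exI[of _ 0])
next
  case (runs_step c k)
  show ?case
  proof (cases "\<exists>a\<in>enabled M x c. cs (Suc 0) = perform x a c")
    case True
    then obtain a where a: "a \<in> enabled M x c" "cs (Suc 0) = perform x a c" by blast
    then show ?thesis using runs_step(5)[OF a(1), of "\<lambda>k. cs (Suc k)"] by auto
  next
    case False
    then show ?thesis using runs_step(6) by (auto intro!: exI[of _ 0])
  qed
qed

lemma runs_initial: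
  assumes "runs M x b (initial M) k"
  shows "halts_on_every_path M x" "space_le M x b" "card (accepting_paths M x) = k"
proof -
  show "halts_on_every_path M x"
    unfolding halts_on_every_path_def using runs_halts[OF assms] by metis
  show "space_le M x b"
    unfolding space_le_def
  proof (intro allI impI)
    fix as q i ts assume "path M x (initial M) as (q, i, ts)"
    from runs_fits[OF assms this] show "\<forall>(t, h)\<in>set ts. h < b" by simp
  qed
  show "card (accepting_paths M x) = k"
    using runs_card[OF assms] by (simp add: accepting_from_def accepting_paths_def)
qed

section \<open>Binary counters\<close>

text \<open>Symbol 1 is the digit one, 2 is the digit zero, 0 is the blank beyond the leading digit and 3
  marks the left end; the least significant digit is in cell 1.\<close>

definition dig :: "nat \<Rightarrow> nat \<Rightarrow> nat" where
  "dig v i = (if v < 2 ^ i then 0 else if odd (v div 2 ^ i) then 1 else 2)"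

definition numtape :: "nat \<Rightarrow> nat \<Rightarrow> nat" where
  "numtape v p = (if p = 0 then 3 else dig v (p - 1))"

text \<open>The tape while \<open>v\<close> is incremented, once the carry has passed \<open>i\<close> digits.\<close>

definition carrytape :: "nat \<Rightarrow> nat \<Rightarrow> nat \<Rightarrow> nat" where
  "carrytape i v p = (if p = 0 then 3 else if p \<le> i then 2 else dig v (p - 1))"

lemma dig_0: "dig 0 i = 0"
  by (simp add: dig_def)

lemma dig_neq_3: "dig v i \<noteq> 3"
  by (auto simp: dig_def)

lemma carrytape_0: "carrytape 0 v = numtape v"
  by (auto simp: carrytape_def numtape_def fun_eq_iff)

lemma carrytape_Suc: "(carrytape i v)(Suc i := 2) = carrytape (Suc i) v"
  by (auto simp: carrytape_def fun_eq_iff)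

lemma all_ones_Suc:
  assumes "v mod 2 ^ i = 2 ^ i - 1" "dig v i = 1"
  shows "v mod 2 ^ Suc i = 2 ^ Suc i - (1::nat)"
proof -
  have "odd (v div 2 ^ i)" using assms(2) by (auto simp: dig_def split: if_splits)
  then have "v mod 2 ^ Suc i = 2 ^ i + v mod 2 ^ i"
    by (simp add: mod_mult2_eq[of v "2 ^ i" 2, simplified mult.commute[of _ 2]] odd_iff_mod_2_eq_one)
  then show ?thesis using assms(1) by simp
qed

text \<open>With \<open>v = 2 ^ i * u + (2 ^ i - 1)\<close> and \<open>u\<close> even,
  \<open>Suc v = 2 ^ i * Suc u\<close>: the low digits become zero, digit \<open>i\<close> becomes
  one, the higher ones stay. A blank at \<open>i\<close> is the case \<open>u = 0\<close>, where the
  number gains a digit.\<close>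

lemma carrytape_final:
  assumes "v mod 2 ^ i = 2 ^ i - 1" "dig v i \<noteq> 1"
  shows "(carrytape i v)(Suc i := 1) = numtape (Suc v)"
proof
  fix p
  define u where "u = v div 2 ^ i"
  have v: "v = 2 ^ i * u + (2 ^ i - 1)"
    using assms(1) mult_div_mod_eq[of "2 ^ i" v] by (simp add: u_def)
  then have Sv: "Suc v = 2 ^ i * Suc u" by simp
  have "even u" using assms(2) by (auto simp: dig_def u_def split: if_splits)
  consider "p = 0" | q where "p = Suc q" "q < i" | "p = Suc i" | q where "p = Suc q" "i < q"
    by (cases p) (auto, metis linorder_neqE_nat)
  then show "((carrytape i v)(Suc i := 1)) p = numtape (Suc v) p"
  proof cases
    case 1
    then show ?thesis by (simp add: carrytape_def numtape_def)
  next
    case 2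
    have i: "(2::nat) ^ i = 2 ^ q * (2 * 2 ^ (i - Suc q))"
      using 2 by (metis Suc_leI le_add_diff_inverse power_Suc power_add mult.commute add_Suc_shift mult.assoc power_commutes)
    have "Suc v = 2 ^ q * (2 * 2 ^ (i - Suc q) * Suc u)" unfolding Sv i by (simp only: mult.assoc)
    then have "dig (Suc v) q = 2" by (auto simp: dig_def)
    then show ?thesis using 2 by (simp add: carrytape_def numtape_def)
  next
    case 3
    have "dig (Suc v) i = 1" using \<open>even u\<close> unfolding Sv by (auto simp: dig_def)
    then show ?thesis using 3 by (simp add: numtape_def)
  next
    case 4
    then obtain d where d: "q = Suc (i + d)" by (metis less_iff_Suc_add)
    have "(2::nat) ^ q = 2 ^ i * 2 * 2 ^ d" by (simp add: d power_add)
    then have div: "w div 2 ^ q = (w div 2 ^ i) div 2 div 2 ^ d" for w :: nat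
      by (simp only: div_mult2_eq)
    have "Suc v div 2 ^ i = Suc u" unfolding Sv by simp
    moreover have "Suc u div 2 = u div 2" using \<open>even u\<close> by simp
    ultimately have eq: "Suc v div 2 ^ q = v div 2 ^ q"
      unfolding div u_def[symmetric] by simp
    have "w < 2 ^ q \<longleftrightarrow> w div 2 ^ q = 0" for w :: nat
      by (simp add: div_eq_0_iff)
    then have "dig (Suc v) q = dig v q" using eq by (simp add: dig_def)
    then show ?thesis using 4 by (simp add: carrytape_def numtape_def)
  qed
qed

section \<open>Logarithmic size of the counters\<close>

definition bitlen :: "nat \<Rightarrow> nat" where
  "bitlen m = (LEAST L. m < 2 ^ L)"

lemma less_bitlen: "m < 2 ^ bitlen m"
  unfolding bitlen_def by (rule LeastI[of _ m]) simp

lemma bitlen_le: "m < 2 ^ L \<Longrightarrow> bitlen m \<le> L"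
  unfolding bitlen_def by (rule Least_le)

text \<open>For \<open>m \<ge> 2\<close> both \<open>bitlen m - 1\<close> and 1 are at most
  \<open>ln m / ln 2\<close>; counting the first once and the second \<open>k + 1\<close> times
  gives the factor \<open>k + 2\<close>.\<close>

lemma bitlen_bigo: "(\<lambda>m. real (bitlen m + k)) \<in> O(\<lambda>m. ln (real m))"
proof (rule bigoI)
  have "real (bitlen m + k) \<le> (real (k + 2) / ln 2) * ln (real m)" if "m \<ge> 2" for m
  proof -
    have "(2::nat) ^ (bitlen m - 1) \<le> m"
      using bitlen_le[of m "bitlen m - 1"] less_bitlen[of m] that
      by (cases "bitlen m") (auto simp: not_less[symmetric])
    then have "real (2 ^ (bitlen m - 1)) \<le> real m" by (rule of_nat_mono)
    then have "ln (real (2 ^ (bitlen m - 1))) \<le> ln (real m)"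
      using that by (subst ln_le_cancel_iff) auto
    then have 1: "real (bitlen m - 1) * ln 2 \<le> ln (real m)"
      by (simp add: ln_realpow)
    have 2: "ln 2 \<le> ln (real m)" using that by simp
    have "real (bitlen m + k) \<le> real (bitlen m - 1) + real (k + 1)" by simp
    then have "real (bitlen m + k) * ln 2 \<le> (real (bitlen m - 1) + real (k + 1)) * ln 2"
      by (rule mult_right_mono) simp
    also have "\<dots> \<le> ln (real m) + real (k + 1) * ln (real m)"
      using 1 mult_left_mono[OF 2, of "real (k + 1)"] by (simp add: algebra_simps)
    finally show ?thesis by (simp add: field_simps)
  qed
  then show "\<forall>\<^sub>F m in at_top. norm (real (bitlen m + k)) \<le> (real (k + 2) / ln 2) * norm (ln (real m))"
    by (intro eventually_at_top_linorderI[of 2]) auto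
qed

section \<open>A machine for systems of linear inequalities\<close>

text \<open>\<open>Read b\<close> scans block \<open>b\<close> of the input, \<open>Inc b\<close>
  propagates the carry in counter \<open>b\<close>, \<open>Ret b\<close> brings its head back, and
  \<open>Sweep cs gs\<close> holds one carry per inequality and the digits guessed last.\<close>

datatype phase = Init | Read nat | Inc nat | Ret nat | Sweep "int list" "bool list"

instance phase :: countable
  by countable_datatype

definition keep :: "nat list \<Rightarrow> (nat \<times> dir) list" where
  "keep ws = map (\<lambda>w. (w, Stay)) ws"

text \<open>A system of \<open>length A\<close> homogeneous linear inequalities in \<open>N\<close> given and \<open>r\<close> guessed
  unknowns; the rows of \<open>A\<close> list the coefficients of the given unknowns first.\<close>

locale linear_system =
  fixes N r :: nat and A :: "(nat \<Rightarrow> int) list"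
begin

text \<open>The contribution of one digit position to an inequality, before the incoming carry is
  added. Only symbol 1 counts, so the blanks beyond a shorter number act as zeros.\<close>

definition carry :: "(nat \<Rightarrow> int) \<Rightarrow> nat list \<Rightarrow> bool list \<Rightarrow> int" where
  "carry a ws g = (\<Sum>j<N. a j * of_bool (ws ! j = 1)) + (\<Sum>j<r. a (N + j) * of_bool (g ! j))"

definition carries :: "int list \<Rightarrow> nat list \<Rightarrow> bool list \<Rightarrow> int list" where
  "carries cs ws g = map (\<lambda>k. (cs ! k + carry (A ! k) ws g) div 2) [0..<length A]"

text \<open>The guessed bits are part of the new state, so that different guesses are different
  transitions.\<close>

fun step :: "phase \<Rightarrow> insym \<Rightarrow> nat list \<Rightarrow> (phase \<times> dir \<times> (nat \<times> dir) list) set" where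
  "step Init a ws = {(Read 0, Right, map (\<lambda>w. (3, Right)) ws)}"
| "step (Read b) LeftEnd ws = {}"
| "step (Read b) (Bit True) ws = (if b < N then {(Inc b, Right, keep ws)} else {})"
| "step (Read b) (Bit False) ws = (if Suc b < N then {(Read (Suc b), Right, keep ws)} else {})"
| "step (Read b) RightEnd ws =
     (if N \<le> Suc b then {(Sweep (replicate (length A) 0) [], Stay, keep ws)} else {})"
| "step (Inc b) a ws =
     (if b < N then {if ws ! b = 1 then (Inc b, Stay, (keep ws)[b := (2, Right)])
                     else (Ret b, Stay, (keep ws)[b := (1, Left)])} else {})"
| "step (Ret b) a ws =
     (if b < N then {if ws ! b = 3 then (Read b, Stay, (keep ws)[b := (3, Right)])
                     else (Ret b, Stay, (keep ws)[b := (ws ! b, Left)])} else {})"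
| "step (Sweep cs gs) a ws =
     (if set ws \<subseteq> {0} then {}
      else (\<lambda>g. (Sweep (carries cs ws g) g, Stay, map (\<lambda>w. (w, Right)) ws)) ` {g. length g = r})"

text \<open>Dominates the contribution of a digit position to every inequality. Since
  \<open>(c + s) div 2\<close> stays between \<open>- K\<close> and \<open>K\<close> whenever
  \<open>c\<close> and \<open>s\<close> do, it bounds all carries as well and keeps the set of
  phases finite.\<close>

definition bound :: int where
  "bound = (\<Sum>a\<leftarrow>A. \<Sum>j<N + r. \<bar>a j\<bar>)"

text \<open>\<open>Read\<close> ranges up to \<open>N\<close> inclusive so that the first phase
  \<open>Read 0\<close> is present for \<open>N = 0\<close> too. Guesses may be shorter than
  \<open>r\<close> because the sweep starts with the empty list.\<close>

definition phases :: "phase set" where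
  "phases = {Init} \<union> Read ` {..N} \<union> Inc ` {..<N} \<union> Ret ` {..<N} \<union>
     {Sweep cs gs | cs gs. set cs \<subseteq> {- bound..bound} \<and> length cs = length A \<and> length gs \<le> r}"

text \<open>Acceptance only takes effect in halting configurations, so the nonnegative carries are
  in effect tested when all digits have been consumed.\<close>

definition mach :: machine where
  "mach = \<lparr>states = to_nat ` phases, alphabet = {..3}, tapes = N, start = to_nat Init,
     accept = to_nat ` {Sweep cs gs | cs gs. Sweep cs gs \<in> phases \<and> (\<forall>c\<in>set cs. 0 \<le> c)},
     delta = \<lambda>q a ws. (\<lambda>(s, d, acts). (to_nat s, d, acts)) ` step (from_nat q) a ws\<rparr>"

lemma finite_phases: "finite phases"
proof -
  have "{Sweep cs gs | cs gs. set cs \<subseteq> {- bound..bound} \<and> length cs = length A \<and> length gs \<le> r} =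
      (\<lambda>(cs, gs). Sweep cs gs) ` ({cs. set cs \<subseteq> {- bound..bound} \<and> length cs = length A} \<times>
        {gs. set gs \<subseteq> UNIV \<and> length gs \<le> r})"
    by auto
  also have "finite \<dots>"
    by (intro finite_imageI finite_cartesian_product finite_lists_length_eq finite_lists_length_le) auto
  finally show ?thesis by (simp add: phases_def)
qed

lemma bound_nonneg: "0 \<le> bound"
  unfolding bound_def by (intro sum_list_nonneg) (auto intro: sum_nonneg)

lemma carry_le_bound:
  assumes "k < length A"
  shows "\<bar>carry (A ! k) ws g\<bar> \<le> bound"
proof -
  have "\<bar>carry (A ! k) ws g\<bar> \<le> (\<Sum>j<N. \<bar>(A ! k) j\<bar>) + (\<Sum>j<r. \<bar>(A ! k) (N + j)\<bar>)"
    unfolding carry_def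
    by (rule order_trans[OF abs_triangle_ineq], intro add_mono order_trans[OF sum_abs] sum_mono)
      (auto simp: abs_mult)
  also have "\<dots> = (\<Sum>j<N + r. \<bar>(A ! k) j\<bar>)"
    by (induction r) (auto simp: add.assoc)
  also have "\<dots> \<le> bound"
    unfolding bound_def using assms
    by (intro member_le_sum_list) (auto intro: sum_nonneg)
  finally show ?thesis .
qed

lemma carries_bound:
  assumes "set cs \<subseteq> {- bound..bound}" "length cs = length A"
  shows "set (carries cs ws g) \<subseteq> {- bound..bound}"
proof -
  have half: "- K \<le> (c + s) div 2 \<and> (c + s) div 2 \<le> K"
    if "- K \<le> c" "c \<le> K" "\<bar>s\<bar> \<le> K" for c s K :: int
    using that by linarith
  have "(cs ! k + carry (A ! k) ws g) div 2 \<in> {- bound..bound}" if "k < length A" for k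
  proof -
    have "cs ! k \<in> {- bound..bound}" using subsetD[OF assms(1) nth_mem] assms(2) that by simp
    then show ?thesis
      using half[OF _ _ carry_le_bound[OF that, of ws g]] unfolding atLeastAtMost_iff by blast
  qed
  then show ?thesis by (auto simp: carries_def)
qed

lemma fst_keep_update:
  assumes "set ws \<subseteq> {..3}" "w \<le> 3"
  shows "fst ` set ((keep ws)[b := (w, e)]) \<subseteq> {..3}"
proof -
  have "fst ` set ((keep ws)[b := (w, e)]) \<subseteq> fst ` insert (w, e) (set (keep ws))"
    by (intro image_mono set_update_subset_insert)
  also have "\<dots> \<subseteq> {..3}" using assms by (auto simp: keep_def)
  finally show ?thesis .
qed

lemma step_closed:
  assumes "q \<in> phases" "length ws = N" "set ws \<subseteq> {..3}" "(q', d, acts) \<in> step q a ws"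
  shows "q' \<in> phases \<and> length acts = N \<and> fst ` set acts \<subseteq> {..3}"
proof (cases q)
  case Init
  then show ?thesis using assms by (auto simp: phases_def)
next
  case (Read b)
  have k: "length (keep ws) = N" "fst ` set (keep ws) \<subseteq> {..3}" using assms by (auto simp: keep_def)
  have *: "Sweep (replicate (length A) 0) [] \<in> phases"
    using bound_nonneg by (auto simp: phases_def)
  show ?thesis
  proof (cases a)
    case LeftEnd
    then show ?thesis using assms Read by simp
  next
    case (Bit c)
    then show ?thesis using assms Read k by (cases c) (auto simp: phases_def split: if_splits)
  next
    case RightEnd
    then show ?thesis using assms Read k * by (auto split: if_splits)
  qed
next
  case (Inc b)
  have "length (keep ws) = N" using assms(2) by (simp add: keep_def)
  then show ?thesis
    using assms Inc fst_keep_update[OF assms(3), of 1 b Left] fst_keep_update[OF assms(3), of 2 b Right]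
    by (simp add: phases_def split: if_splits)
next
  case (Ret b)
  then have "b < N" using assms(1) by (auto simp: phases_def)
  then have "ws ! b \<le> 3" using assms(2,3) by (metis atMost_iff nth_mem subsetD)
  moreover have "length (keep ws) = N" using assms(2) by (simp add: keep_def)
  ultimately show ?thesis
    using assms Ret fst_keep_update[OF assms(3), of 3 b Right] fst_keep_update[OF assms(3), of "ws ! b" b Left]
    by (simp add: phases_def split: if_splits)
next
  case (Sweep cs gs)
  then have "set cs \<subseteq> {- bound..bound}" "length cs = length A" using assms(1) by (auto simp: phases_def)
  from carries_bound[OF this] show ?thesis
    using assms Sweep by (auto simp: phases_def carries_def split: if_splits)
qed

lemma ntm_mach: "ntm mach"
  unfolding ntm_def
proof (intro conjI)
  show "\<forall>q\<in>states mach. \<forall>a ws. length ws = tapes mach \<and> set ws \<subseteq> alphabet mach \<longrightarrow>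
      delta mach q a ws \<subseteq> {(q', d, acts). q' \<in> states mach \<and> length acts = tapes mach \<and>
        fst ` set acts \<subseteq> alphabet mach}"
  proof (intro ballI allI impI subsetI)
    fix q a ws t
    assume q: "q \<in> states mach" and ws: "length ws = tapes mach \<and> set ws \<subseteq> alphabet mach"
      and t: "t \<in> delta mach q a ws"
    obtain p where p: "q = to_nat p" "p \<in> phases" using q by (auto simp: mach_def)
    obtain q' d acts where s: "(q', d, acts) \<in> step p a ws" "t = (to_nat q', d, acts)"
      using t p by (auto simp: mach_def)
    from step_closed[OF p(2) _ _ s(1)] ws s(2)
    show "t \<in> {(q', d, acts). q' \<in> states mach \<and> length acts = tapes mach \<and>
        fst ` set acts \<subseteq> alphabet mach}"
      by (simp add: mach_def)
  qed
qed (use finite_phases in \<open>auto simp: mach_def phases_def\<close>)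

section \<open>Configurations and the increment of a counter\<close>

definition conf :: "phase \<Rightarrow> nat \<Rightarrow> (nat \<Rightarrow> nat \<Rightarrow> nat) \<Rightarrow> (nat \<Rightarrow> nat) \<Rightarrow> config" where
  "conf q i T H = (to_nat q, i, map (\<lambda>j. (T j, H j)) [0..<N])"

definition scanned :: "(nat \<Rightarrow> nat \<Rightarrow> nat) \<Rightarrow> (nat \<Rightarrow> nat) \<Rightarrow> nat list" where
  "scanned T H = map (\<lambda>j. T j (H j)) [0..<N]"

lemma conf_cong:
  "(\<And>j. j < N \<Longrightarrow> T j = T' j) \<Longrightarrow> (\<And>j. j < N \<Longrightarrow> H j = H' j) \<Longrightarrow> conf q i T H = conf q i T' H'"
  by (simp add: conf_def)

lemma length_scanned: "length (scanned T H) = N"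
  by (simp add: scanned_def)

lemma nth_scanned: "j < N \<Longrightarrow> scanned T H ! j = T j (H j)"
  by (simp add: scanned_def)

lemma enabled_conf:
  "enabled mach x (conf q i T H) =
    (\<lambda>(s, d, acts). (to_nat s, d, acts)) ` step q (read_input x i) (scanned T H)"
  by (simp add: conf_def mach_def scanned_def o_def)

lemma perform_conf:
  assumes "length acts = N"
  shows "perform x (to_nat s, d, acts) (conf q i T H) =
    conf s (min (move d i) (length x + 1)) (\<lambda>j. (T j)(H j := fst (acts ! j))) (\<lambda>j. move (snd (acts ! j)) (H j))"
  using assms by (auto simp: conf_def case_prod_unfold intro!: nth_equalityI)

lemma fits_conf: "fits b (conf q i T H) \<longleftrightarrow> (\<forall>j<N. H j < b)"
  by (auto simp: conf_def)

lemma runs_conf: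
  assumes "step q (read_input x i) (scanned T H) = {(s, d, acts)}" "length acts = N"
    and "\<And>j. j < N \<Longrightarrow> H j < b"
    and "runs mach x b (conf s (min (move d i) (length x + 1))
      (\<lambda>j. (T j)(H j := fst (acts ! j))) (\<lambda>j. move (snd (acts ! j)) (H j))) k"
  shows "runs mach x b (conf q i T H) k"
  by (rule runs_det[where a = "(to_nat s, d, acts)"])
    (use assms in \<open>auto simp: fits_conf enabled_conf perform_conf\<close>)

lemma runs_conf_keep:
  assumes "step q (read_input x i) (scanned T H) = {(s, d, keep (scanned T H))}"
    and "\<And>j. j < N \<Longrightarrow> H j < b"
    and "runs mach x b (conf s (min (move d i) (length x + 1)) T H) k"
  shows "runs mach x b (conf q i T H) k"
proof (rule runs_conf[OF assms(1)])
  show "length (keep (scanned T H)) = N" by (simp add: keep_def scanned_def)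
  have "conf s (min (move d i) (length x + 1)) (\<lambda>j. (T j)(H j := fst (keep (scanned T H) ! j)))
      (\<lambda>j. move (snd (keep (scanned T H) ! j)) (H j)) = conf s (min (move d i) (length x + 1)) T H"
    by (rule conf_cong) (auto simp: keep_def length_scanned nth_scanned)
  then show "runs mach x b (conf s (min (move d i) (length x + 1))
      (\<lambda>j. (T j)(H j := fst (keep (scanned T H) ! j))) (\<lambda>j. move (snd (keep (scanned T H) ! j)) (H j))) k"
    using assms(3) by simp
qed (use assms in auto)

lemma runs_conf_update:
  assumes "step q (read_input x i) (scanned T H) = {(s, Stay, (keep (scanned T H))[p := (w, e)])}"
    and "i \<le> length x + 1" "p < N" and "\<And>j. j < N \<Longrightarrow> H j < b"
    and "runs mach x b (conf s i (T(p := (T p)(H p := w))) (H(p := move e (H p)))) k"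
  shows "runs mach x b (conf q i T H) k"
proof (rule runs_conf[OF assms(1)])
  let ?a = "(keep (scanned T H))[p := (w, e)]"
  show "length ?a = N" by (simp add: keep_def scanned_def)
  have "conf s (min (move Stay i) (length x + 1)) (\<lambda>j. (T j)(H j := fst (?a ! j)))
      (\<lambda>j. move (snd (?a ! j)) (H j)) = conf s i (T(p := (T p)(H p := w))) (H(p := move e (H p)))"
    unfolding min_absorb1[OF assms(2)] move.simps
    by (rule conf_cong) (auto simp: keep_def length_scanned nth_scanned nth_list_update assms(3))
  then show "runs mach x b (conf s (min (move Stay i) (length x + 1))
      (\<lambda>j. (T j)(H j := fst (?a ! j))) (\<lambda>j. move (snd (?a ! j)) (H j))) k"
    using assms(5) by simp
qed (use assms in auto)

text \<open>The head rewrites what it reads until it meets the mark 3 in cell 0, and then steps back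
  to cell 1.\<close>

lemma runs_Ret:
  assumes "p < N" "i \<le> length x + 1" "\<And>j. j < N \<Longrightarrow> V j < 2 ^ L" "h \<le> L" "L + 2 \<le> b"
    and "runs mach x b (conf (Read p) i (\<lambda>j. numtape (V j)) (\<lambda>_. 1)) k"
  shows "runs mach x b (conf (Ret p) i (\<lambda>j. numtape (V j)) ((\<lambda>_. 1)(p := h))) k"
  using assms(4)
proof (induction h)
  case 0
  let ?T = "\<lambda>j. numtape (V j)" and ?H = "(\<lambda>_. 1)(p := 0)"
  show ?case
  proof (rule runs_conf_update[where p = p and w = 3 and e = Right and s = "Read p"])
    show "step (Ret p) (read_input x i) (scanned ?T ?H) =
        {(Read p, Stay, (keep (scanned ?T ?H))[p := (3, Right)])}"
      using assms(1) by (simp add: nth_scanned numtape_def)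
    have "?T(p := (?T p)(?H p := 3)) = ?T" "?H(p := move Right (?H p)) = (\<lambda>_. 1)"
      by (auto simp: numtape_def fun_eq_iff)
    then show "runs mach x b (conf (Read p) i (?T(p := (?T p)(?H p := 3))) (?H(p := move Right (?H p)))) k"
      using assms(6) by simp
  qed (use assms in auto)
next
  case (Suc h)
  let ?T = "\<lambda>j. numtape (V j)" and ?H = "(\<lambda>_. 1)(p := Suc h)"
  show ?case
  proof (rule runs_conf_update[where p = p and w = "dig (V p) h" and e = Left and s = "Ret p"])
    show "step (Ret p) (read_input x i) (scanned ?T ?H) =
        {(Ret p, Stay, (keep (scanned ?T ?H))[p := (dig (V p) h, Left)])}"
      using assms(1) by (simp add: nth_scanned numtape_def dig_neq_3)
    have eq: "?T(p := (?T p)(?H p := dig (V p) h)) = ?T" "?H(p := move Left (?H p)) = (\<lambda>_. 1)(p := h)"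
      by (auto simp: numtape_def fun_eq_iff)
    show "runs mach x b (conf (Ret p) i (?T(p := (?T p)(?H p := dig (V p) h))) (?H(p := move Left (?H p)))) k"
      unfolding eq by (rule Suc.IH) (use Suc.prems in simp)
  qed (use assms Suc.prems in auto)
qed

text \<open>The digits below \<open>h\<close> were all ones and have been cleared. The head stands
  in cell \<open>Suc h\<close> with \<open>h \<le> L\<close>, hence never beyond
  \<open>L + 1\<close>; this is where the space \<open>L + 2\<close> comes from.\<close>

lemma runs_Inc:
  assumes "p < N" "i \<le> length x + 1" "\<And>j. j < N \<Longrightarrow> V j < 2 ^ L" "Suc (V p) < 2 ^ L" "L + 2 \<le> b"
    and "runs mach x b (conf (Read p) i (\<lambda>j. numtape ((V(p := Suc (V p))) j)) (\<lambda>_. 1)) k"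
    and "h \<le> L" "V p mod 2 ^ h = 2 ^ h - 1"
  shows "runs mach x b (conf (Inc p) i ((\<lambda>j. numtape (V j))(p := carrytape h (V p)))
    ((\<lambda>_. 1)(p := Suc h))) k"
  using assms(7,8)
proof (induction "L - h" arbitrary: h rule: less_induct)
  case less
  let ?T = "(\<lambda>j. numtape (V j))(p := carrytape h (V p))" and ?H = "(\<lambda>_. 1)(p := Suc h) :: nat \<Rightarrow> nat"
  have H: "?H j < b" for j using assms(5) less.prems by auto
  have scan: "scanned ?T ?H ! p = dig (V p) h"
    using assms(1) by (simp add: nth_scanned carrytape_def)
  show ?case
  proof (cases "dig (V p) h = 1")
    case True
    \<comment> \<open>A digit one at \<open>h\<close> forces \<open>h < L\<close>, so the carry can
      move on within the allotted cells.\<close>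
    then have "2 ^ h \<le> V p" by (auto simp: dig_def split: if_splits)
    then have "(2::nat) ^ h < 2 ^ L" using assms(3)[OF assms(1)] by (rule le_less_trans)
    then have "h < L" by simp
    show ?thesis
    proof (rule runs_conf_update[where p = p and w = 2 and e = Right and s = "Inc p"])
      show "step (Inc p) (read_input x i) (scanned ?T ?H) =
          {(Inc p, Stay, (keep (scanned ?T ?H))[p := (2, Right)])}"
        using assms(1) scan True by simp
      have eq: "?T(p := (?T p)(?H p := 2)) = (\<lambda>j. numtape (V j))(p := carrytape (Suc h) (V p))"
        "?H(p := move Right (?H p)) = (\<lambda>_. 1)(p := Suc (Suc h))"
        by (auto simp: carrytape_Suc)
      show "runs mach x b (conf (Inc p) i (?T(p := (?T p)(?H p := 2))) (?H(p := move Right (?H p)))) k"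
        unfolding eq using \<open>h < L\<close> all_ones_Suc[OF less.prems(2) True] by (intro less.hyps) auto
    qed (use assms H in auto)
  next
    case False
    show ?thesis
    proof (rule runs_conf_update[where p = p and w = 1 and e = Left and s = "Ret p"])
      show "step (Inc p) (read_input x i) (scanned ?T ?H) =
          {(Ret p, Stay, (keep (scanned ?T ?H))[p := (1, Left)])}"
        using assms(1) scan False by simp
      have eq: "?T(p := (?T p)(?H p := 1)) = (\<lambda>j. numtape ((V(p := Suc (V p))) j))"
        "?H(p := move Left (?H p)) = (\<lambda>_. 1)(p := h)"
        using carrytape_final[OF less.prems(2) False] by (auto simp: fun_eq_iff)
      show "runs mach x b (conf (Ret p) i (?T(p := (?T p)(?H p := 1))) (?H(p := move Left (?H p)))) k"
        unfolding eq using assms less.prems by (intro runs_Ret[where L = L]) auto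
    qed (use assms H in auto)
  qed
qed

end

section \<open>The digit sweep and the solutions it counts\<close>

context linear_system
begin

text \<open>What remains of the system at digit position \<open>t\<close>: the given numbers without
  their first \<open>t\<close> digits, unknowns with at most \<open>L - t\<close> digits to come,
  and in \<open>cs\<close> the carries from below.\<close>

definition solutions :: "nat \<Rightarrow> nat \<Rightarrow> (nat \<Rightarrow> nat) \<Rightarrow> int list \<Rightarrow> nat list set" where
  "solutions L t V cs = {v. length v = r \<and> set v \<subseteq> {..<2 ^ (L - t)} \<and>
     (\<forall>k<length A. 0 \<le> cs ! k + (\<Sum>j<N. (A ! k) j * int (V j div 2 ^ t)) +
        (\<Sum>j<r. (A ! k) (N + j) * int (v ! j)))}"

lemma dig_eq_1_iff: "dig v t = 1 \<longleftrightarrow> odd (v div 2 ^ t)"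
  by (auto simp: dig_def)

lemma dig_eq_0_iff: "dig v t = 0 \<longleftrightarrow> v < 2 ^ t"
  by (simp add: dig_def)

lemma int_split_bit: "int m = of_bool (odd m) + 2 * int (m div 2)"
  by (cases "even m") (auto elim!: evenE oddE)

text \<open>Rounding the carry loses nothing: \<open>s + 2 y \<ge> 0\<close> iff \<open>s div 2 + y \<ge> 0\<close> for integers.\<close>

lemma solutions_step:
  assumes "length v = r" "t < L"
    and ws: "\<And>j. j < N \<Longrightarrow> ws ! j = dig (V j) t"
  shows "v \<in> solutions L t V cs \<longleftrightarrow>
    map (\<lambda>w. w div 2) v \<in> solutions L (Suc t) V (carries cs ws (map odd v))"
proof -
  have pow: "(2::nat) ^ (L - t) = 2 * 2 ^ (L - Suc t)"
    using assms(2) by (metis Suc_diff_Suc power_Suc)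
  have "set v \<subseteq> {..<2 ^ (L - t)} \<longleftrightarrow> set (map (\<lambda>w. w div 2) v) \<subseteq> {..<2 ^ (L - Suc t)}"
    unfolding pow by (auto simp: subset_iff less_mult_imp_div_less mult.commute div_less_iff_less_mult)
  moreover have "0 \<le> cs ! k + (\<Sum>j<N. (A ! k) j * int (V j div 2 ^ t)) +
        (\<Sum>j<r. (A ! k) (N + j) * int (v ! j)) \<longleftrightarrow>
      0 \<le> carries cs ws (map odd v) ! k + (\<Sum>j<N. (A ! k) j * int (V j div 2 ^ Suc t)) +
        (\<Sum>j<r. (A ! k) (N + j) * int (map (\<lambda>w. w div 2) v ! j))" if "k < length A" for k
  proof -
    define a where "a = A ! k"
    define y where "y = (\<Sum>j<N. a j * int (V j div 2 ^ Suc t)) + (\<Sum>j<r. a (N + j) * int (v ! j div 2))"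
    have "(\<Sum>j<N. a j * int (V j div 2 ^ t)) =
        (\<Sum>j<N. a j * of_bool (ws ! j = 1)) + 2 * (\<Sum>j<N. a j * int (V j div 2 ^ Suc t))"
      unfolding sum_distrib_left sum.distrib[symmetric]
    proof (rule sum.cong[OF refl])
      fix j assume "j \<in> {..<N}"
      then have "ws ! j = 1 \<longleftrightarrow> odd (V j div 2 ^ t)" using ws[of j] dig_eq_1_iff[of "V j" t] by simp
      moreover have "V j div 2 ^ Suc t = V j div 2 ^ t div 2"
        by (simp only: power_Suc2 div_mult2_eq)
      ultimately show "a j * int (V j div 2 ^ t) =
          a j * of_bool (ws ! j = 1) + 2 * (a j * int (V j div 2 ^ Suc t))"
        using int_split_bit[of "V j div 2 ^ t"] by (simp only: algebra_simps)
    qed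
    moreover have "(\<Sum>j<r. a (N + j) * int (v ! j)) =
        (\<Sum>j<r. a (N + j) * of_bool (map odd v ! j)) + 2 * (\<Sum>j<r. a (N + j) * int (v ! j div 2))"
      unfolding sum_distrib_left sum.distrib[symmetric]
    proof (rule sum.cong[OF refl])
      fix j assume "j \<in> {..<r}"
      then have "map odd v ! j = odd (v ! j)" using assms(1) by simp
      then show "a (N + j) * int (v ! j) =
          a (N + j) * of_bool (map odd v ! j) + 2 * (a (N + j) * int (v ! j div 2))"
        using int_split_bit[of "v ! j"] by (simp only: algebra_simps)
    qed
    ultimately have sum: "(\<Sum>j<N. a j * int (V j div 2 ^ t)) + (\<Sum>j<r. a (N + j) * int (v ! j)) =
        carry a ws (map odd v) + 2 * y"
      by (simp add: carry_def y_def)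
    have "carries cs ws (map odd v) ! k = (cs ! k + carry a ws (map odd v)) div 2"
      using that by (simp add: carries_def a_def)
    moreover have "(\<Sum>j<r. a (N + j) * int (map (\<lambda>w. w div 2) v ! j)) = (\<Sum>j<r. a (N + j) * int (v ! j div 2))"
      using assms(1) by (intro sum.cong) auto
    ultimately have new: "carries cs ws (map odd v) ! k + (\<Sum>j<N. a j * int (V j div 2 ^ Suc t)) +
        (\<Sum>j<r. a (N + j) * int (map (\<lambda>w. w div 2) v ! j)) =
        (cs ! k + carry a ws (map odd v)) div 2 + y"
      by (simp add: y_def)
    have now: "cs ! k + (\<Sum>j<N. a j * int (V j div 2 ^ t)) + (\<Sum>j<r. a (N + j) * int (v ! j)) =
        (cs ! k + carry a ws (map odd v)) + 2 * y"
      using sum by simp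
    have "0 \<le> s + 2 * u \<longleftrightarrow> 0 \<le> s div 2 + u" for s u :: int by presburger
    then show ?thesis
      unfolding a_def[symmetric] new now .
  qed
  ultimately show ?thesis
    unfolding solutions_def using assms(1) by auto
qed

lemma finite_solutions: "finite (solutions L t V cs)"
  by (rule finite_subset[of _ "{v. set v \<subseteq> {..<2 ^ (L - t)} \<and> length v = r}"])
    (auto simp: solutions_def intro: finite_lists_length_eq)

lemma finite_guesses: "finite {g :: bool list. length g = r}"
  using finite_lists_length_eq[of "UNIV :: bool set" r] by simp

text \<open>Splitting every unknown into its lowest bit and its half is a bijection onto pairs of a
  guess and a solution at the next position.\<close>

lemma card_solutions:
  assumes "t < L" "\<And>j. j < N \<Longrightarrow> ws ! j = dig (V j) t"
  shows "card (solutions L t V cs) =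
    (\<Sum>g | length g = r. card (solutions L (Suc t) V (carries cs ws g)))"
proof -
  let ?S = "SIGMA g:{g. length g = r}. solutions L (Suc t) V (carries cs ws g)"
  let ?f = "\<lambda>v. (map odd v, map (\<lambda>w. w div 2) v)"
  let ?h = "\<lambda>(g, w). map (\<lambda>j. 2 * w ! j + of_bool (g ! j)) [0..<r]"
  note step = solutions_step[where V = V and cs = cs and ws = ws, OF _ assms(1,2)]
  have fh: "?f (?h p) = p" if "p \<in> ?S" for p
    using that by (auto simp: solutions_def intro!: nth_equalityI)
  have "bij_betw ?f (solutions L t V cs) ?S"
  proof (rule bij_betw_byWitness[where f' = ?h])
    show "\<forall>v\<in>solutions L t V cs. ?h (?f v) = v"
      by (auto simp: solutions_def intro!: nth_equalityI)
    show "\<forall>p\<in>?S. ?f (?h p) = p" using fh by blast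
    show "?f ` solutions L t V cs \<subseteq> ?S"
    proof
      fix p assume "p \<in> ?f ` solutions L t V cs"
      then obtain v where v: "v \<in> solutions L t V cs" "p = ?f v" by blast
      have "length v = r" using v by (simp add: solutions_def)
      then show "p \<in> ?S" using step[of v] v by simp
    qed
    show "?h ` ?S \<subseteq> solutions L t V cs"
    proof
      fix v assume "v \<in> ?h ` ?S"
      then obtain p where p: "p \<in> ?S" "v = ?h p" by blast
      have "length v = r" using p by (auto simp: case_prod_unfold)
      then show "v \<in> solutions L t V cs"
        using step[of v] fh[OF p(1)] p by (auto simp: prod_eq_iff)
    qed
  qed
  then have "card (solutions L t V cs) = card ?S" by (rule bij_betw_same_card)
  also have "\<dots> = (\<Sum>g | length g = r. card (solutions L (Suc t) V (carries cs ws g)))"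
    using finite_guesses finite_solutions by (intro card_SigmaI) auto
  finally show ?thesis .
qed

text \<open>\<open>L\<close> is the exact common number of digits of the given values: all scanned
  cells are blank precisely at \<open>t = L\<close>. So every path makes \<open>L - t\<close> more
  guesses, and the choices of digits correspond to the candidate solutions.\<close>

lemma runs_Sweep:
  assumes L: "\<And>t. (\<forall>j<N. V j < 2 ^ t) \<longleftrightarrow> L \<le> t" and "L + 2 \<le> b" "i \<le> length x + 1"
    and "t \<le> L" "set cs \<subseteq> {- bound..bound}" "length cs = length A" "length gs \<le> r"
  shows "runs mach x b (conf (Sweep cs gs) i (\<lambda>j. numtape (V j)) (\<lambda>_. Suc t)) (card (solutions L t V cs))"
  using assms(4-7)
proof (induction "L - t" arbitrary: t cs gs rule: less_induct)
  case less
  let ?T = "\<lambda>j. numtape (V j)" and ?H = "\<lambda>_. Suc t" 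
  let ?ws = "scanned ?T ?H" and ?c = "conf (Sweep cs gs) i ?T ?H"
  have fit: "fits b ?c" using less.prems assms(2) by (simp add: fits_conf)
  have ws: "?ws ! j = dig (V j) t" if "j < N" for j
    using that by (simp add: nth_scanned numtape_def)
  have ws0: "set ?ws \<subseteq> {0} \<longleftrightarrow> (\<forall>j<N. V j < 2 ^ t)"
    by (auto simp: scanned_def numtape_def image_subset_iff dig_eq_0_iff)
  show ?case
  proof (cases "t = L")
    case True
    have en: "enabled mach x ?c = {}"
      using ws0 L[of t] True by (simp add: enabled_conf)
    have V0: "V j div 2 ^ t = 0" if "j < N" for j
      using L[of t] True that by simp
    \<comment> \<open>No digits are left, so all unknowns are zero and each inequality reads
      \<open>0 \<le> cs ! k\<close>.\<close>
    have v0: "length v = r \<and> set v \<subseteq> {..<2 ^ (L - t)} \<longleftrightarrow> v = replicate r 0" for v :: "nat list"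
    proof -
      have "set v \<subseteq> {..<2 ^ (L - t)} \<longleftrightarrow> (\<forall>w\<in>set v. w = 0)" using True by auto
      then show ?thesis by (metis replicate_length_same length_replicate in_set_replicate)
    qed
    have "(\<forall>k<length A. 0 \<le> cs ! k) \<longleftrightarrow> (\<forall>c\<in>set cs. 0 \<le> c)"
      using less.prems by (simp add: all_set_conv_all_nth)
    then have "solutions L t V cs = (if \<forall>c\<in>set cs. 0 \<le> c then {replicate r 0} else {})"
      unfolding solutions_def conj_assoc[symmetric] v0 using V0 by auto
    then have "card (solutions L t V cs) = of_bool (\<forall>c\<in>set cs. 0 \<le> c)" by simp
    also have "(\<forall>c\<in>set cs. 0 \<le> c) \<longleftrightarrow> fst ?c \<in> accept mach"
      using less.prems by (auto simp: conf_def mach_def phases_def)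
    finally show ?thesis using runs_halt[OF fit en] by simp
  next
    case False
    then have "t < L" using less.prems by simp
    let ?F = "\<lambda>g. (to_nat (Sweep (carries cs ?ws g) g), Stay, map (\<lambda>w. (w, Right)) ?ws)"
    let ?G = "{g. length g = r} :: bool list set"
    \<comment> \<open>\<open>runs_step\<close> takes the counts as a function of the transition, so
      the carries are decoded from its target state.\<close>
    define k where "k a = (case from_nat (fst a) of
        Sweep cs' _ \<Rightarrow> card (solutions L (Suc t) V cs') | _ \<Rightarrow> 0)" for a :: action
    have "\<not> set ?ws \<subseteq> {0}" using ws0 L[of t] \<open>t < L\<close> by simp
    then have en: "enabled mach x ?c = ?F ` ?G" by (auto simp: enabled_conf)
    have inj: "inj_on ?F ?G"
    proof (rule inj_onI)
      fix g h assume "?F g = ?F h"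
      then have "Sweep (carries cs ?ws g) g = Sweep (carries cs ?ws h) h"
        by (simp only: prod.inject inj_eq[OF inj_to_nat])
      then show "g = h" by (simp only: phase.inject)
    qed
    have "replicate r True \<in> ?G" by simp
    then have ne: "enabled mach x ?c \<noteq> {}" unfolding en by blast
    have "runs mach x b (perform x a ?c) (k a)" if a: "a \<in> enabled mach x ?c" for a
    proof -
      obtain g where g: "length g = r" "a = ?F g" using a en by auto
      let ?acts = "map (\<lambda>w. (w, Right)) ?ws"
      have "perform x a ?c = conf (Sweep (carries cs ?ws g) g) (min (move Stay i) (length x + 1))
          (\<lambda>j. (?T j)(?H j := fst (?acts ! j))) (\<lambda>j. move (snd (?acts ! j)) (?H j))"
        unfolding g(2) by (rule perform_conf) (simp add: length_scanned)
      also have "\<dots> = conf (Sweep (carries cs ?ws g) g) i ?T (\<lambda>_. Suc (Suc t))"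
        unfolding move.simps min_absorb1[OF assms(3)]
        by (rule conf_cong) (auto simp: length_scanned nth_scanned)
      finally have eq: "perform x a ?c = conf (Sweep (carries cs ?ws g) g) i ?T (\<lambda>_. Suc (Suc t))" .
      have "k a = card (solutions L (Suc t) V (carries cs ?ws g))"
        by (simp add: k_def g(2))
      then show ?thesis
        unfolding eq
        using less.hyps[of "Suc t" "carries cs ?ws g" g] \<open>t < L\<close> g(1)
          carries_bound[OF less.prems(2,3)]
        by (simp add: carries_def)
    qed
    then have "runs mach x b ?c (\<Sum>a\<in>enabled mach x ?c. k a)"
      using finite_guesses by (intro runs_step fit ne) (simp_all add: en)
    also have "(\<Sum>a\<in>enabled mach x ?c. k a) = (\<Sum>g\<in>?G. card (solutions L (Suc t) V (carries cs ?ws g)))"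
      unfolding en sum.reindex[OF inj] by (simp add: k_def)
    also have "\<dots> = card (solutions L t V cs)"
      using card_solutions[OF \<open>t < L\<close>, where ws = ?ws and V = V] ws by simp
    finally show ?thesis .
  qed
qed

section \<open>Reading the unary input\<close>

definition width :: "(nat \<Rightarrow> nat) \<Rightarrow> nat" where
  "width V = (LEAST L. \<forall>j<N. V j < 2 ^ L)"

definition final_count :: "(nat \<Rightarrow> nat) \<Rightarrow> nat" where
  "final_count V = card (solutions (width V) 0 V (replicate (length A) 0))"

text \<open>The deterministic reading phase as a recursion over the rest of the input, with current
  block \<open>p\<close> and counter values \<open>V\<close>. The value 0 stands for a machine stuck
  in a \<open>Read\<close> phase, none of which accepts.\<close>

fun read_count :: "nat \<Rightarrow> (nat \<Rightarrow> nat) \<Rightarrow> bool list \<Rightarrow> nat" where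
  "read_count p V [] = (if N \<le> Suc p then final_count V else 0)"
| "read_count p V (True # ys) = (if p < N then read_count p (V(p := Suc (V p))) ys else 0)"
| "read_count p V (False # ys) = (if Suc p < N then read_count (Suc p) V ys else 0)"

lemma width_iff:
  assumes "\<And>j. j < N \<Longrightarrow> V j < 2 ^ L"
  shows "(\<forall>j<N. V j < 2 ^ t) \<longleftrightarrow> width V \<le> t" "width V \<le> L"
proof -
  have *: "\<forall>j<N. V j < 2 ^ width V"
    unfolding width_def by (rule LeastI[of _ L]) (use assms in blast)
  show "(\<forall>j<N. V j < 2 ^ t) \<longleftrightarrow> width V \<le> t"
  proof
    assume "width V \<le> t"
    then have "(2::nat) ^ width V \<le> 2 ^ t" by simp
    with * show "\<forall>j<N. V j < 2 ^ t" by (meson less_le_trans)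
  qed (unfold width_def, rule Least_le)
  show "width V \<le> L" unfolding width_def by (rule Least_le) (use assms in blast)
qed

lemma runs_stuck:
  assumes "step (Read p) (read_input x i) (scanned T H) = {}" "\<And>j. j < N \<Longrightarrow> H j < b"
  shows "runs mach x b (conf (Read p) i T H) 0"
proof -
  have "fst (conf (Read p) i T H) \<notin> accept mach" by (auto simp: conf_def mach_def)
  then show ?thesis
    using runs_halt[of b "conf (Read p) i T H" mach x] assms by (simp add: fits_conf enabled_conf)
qed

text \<open>The invariant \<open>V j + length ys \<le> length x\<close> expresses that no counter
  outgrows the input, so \<open>bitlen (length x)\<close> digits always suffice.\<close>

lemma runs_Read:
  assumes "1 \<le> i" "i \<le> length x + 1" "drop (i - 1) x = ys" "\<And>j. j < N \<Longrightarrow> V j + length ys \<le> length x"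
    and b: "bitlen (length x) + 2 \<le> b"
  shows "runs mach x b (conf (Read p) i (\<lambda>j. numtape (V j)) (\<lambda>_. 1)) (read_count p V ys)"
  using assms(1-4)
proof (induction ys arbitrary: i V p)
  case Nil
  let ?T = "\<lambda>j. numtape (V j)" and ?H = "\<lambda>_. 1 :: nat"
  have i: "i = length x + 1" using Nil by simp
  have V: "V j < 2 ^ bitlen (length x)" if "j < N" for j
    using Nil(4)[OF that] less_bitlen[of "length x"] by simp
  note w = width_iff[of V, OF V]
  show ?case
  proof (cases "N \<le> Suc p")
    case True
    show ?thesis
    proof (rule runs_conf_keep)
      show "step (Read p) (read_input x i) (scanned ?T ?H) =
          {(Sweep (replicate (length A) 0) [], Stay, keep (scanned ?T ?H))}"
        using True i by (simp add: read_input_def)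
      have "runs mach x b (conf (Sweep (replicate (length A) 0) []) i ?T (\<lambda>_. Suc 0)) (final_count V)"
        unfolding final_count_def
        by (rule runs_Sweep) (use w b i bound_nonneg in auto)
      then show "runs mach x b (conf (Sweep (replicate (length A) 0) []) (min (move Stay i) (length x + 1)) ?T ?H)
          (read_count p V [])"
        using True i by simp
    qed (use b in auto)
  next
    case False
    then show ?thesis
      using runs_stuck[of p x i ?T ?H b] b i by (simp add: read_input_def)
  qed
next
  case (Cons y ys)
  let ?T = "\<lambda>j. numtape (V j)" and ?H = "\<lambda>_. 1 :: nat"
  have len: "i \<le> length x" using Cons.prems(1,3) by (cases "i \<le> length x") auto
  then have nth: "x ! (i - 1) = y" and drop: "drop i x = ys"
    using Cons.prems(1,3) by (metis hd_drop_conv_nth Suc_le_lessD Suc_pred' less_eq_Suc_le list.sel(1) One_nat_def,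
      metis Cons.prems(1,3) drop_Suc tl_drop list.sel(3) Suc_pred' less_eq_Suc_le One_nat_def)
  have inp: "read_input x i = Bit y"
    using len nth Cons.prems(1) by (simp add: read_input_def)
  show ?case
  proof (cases y)
    case True
    show ?thesis
    proof (cases "p < N")
      case p: True
      show ?thesis
      proof (rule runs_conf_keep)
        show "step (Read p) (read_input x i) (scanned ?T ?H) = {(Inc p, Right, keep (scanned ?T ?H))}"
          using inp True p by simp
        have V: "V j < 2 ^ bitlen (length x)" if "j < N" for j
          using Cons.prems(4)[OF that] less_bitlen[of "length x"] by simp
        have "runs mach x b (conf (Inc p) (Suc i) (?T(p := carrytape 0 (V p))) (?H(p := Suc 0)))
            (read_count p (V(p := Suc (V p))) ys)"
        proof (rule runs_Inc[OF p _ V])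
          show "Suc (V p) < 2 ^ bitlen (length x)"
            using Cons.prems(4)[OF p] less_bitlen[of "length x"] by simp
          show "runs mach x b (conf (Read p) (Suc i) (\<lambda>j. numtape ((V(p := Suc (V p))) j)) (\<lambda>_. 1))
              (read_count p (V(p := Suc (V p))) ys)"
          proof (rule Cons.IH)
            show "(V(p := Suc (V p))) j + length ys \<le> length x" if "j < N" for j
              using Cons.prems(4)[OF that] by auto
          qed (use len drop in auto)
        qed (use len b in auto)
        moreover have "?T(p := carrytape 0 (V p)) = ?T" "?H(p := Suc 0) = ?H"
          by (auto simp: carrytape_0)
        ultimately show "runs mach x b (conf (Inc p) (min (move Right i) (length x + 1)) ?T ?H)
            (read_count p V (y # ys))"
          using True p len by simp
      qed (use b in auto)
    next
      case False
      then show ?thesis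
        using runs_stuck[of p x i ?T ?H b] b inp True by simp
    qed
  next
    case False
    show ?thesis
    proof (cases "Suc p < N")
      case p: True
      show ?thesis
      proof (rule runs_conf_keep)
        show "step (Read p) (read_input x i) (scanned ?T ?H) = {(Read (Suc p), Right, keep (scanned ?T ?H))}"
          using inp False p by simp
        have "runs mach x b (conf (Read (Suc p)) (Suc i) ?T ?H) (read_count (Suc p) V ys)"
        proof (rule Cons.IH)
          show "V j + length ys \<le> length x" if "j < N" for j
            using Cons.prems(4)[OF that] by auto
        qed (use len drop in auto)
        then show "runs mach x b (conf (Read (Suc p)) (min (move Right i) (length x + 1)) ?T ?H)
            (read_count p V (y # ys))"
          using False p len by simp
      qed (use b in auto)
    next
      case p: False
      then show ?thesis
        using runs_stuck[of p x i ?T ?H b] b inp False by simp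
    qed
  qed
qed

lemma runs_mach: "runs mach x (bitlen (length x) + 2) (initial mach) (read_count 0 (\<lambda>_. 0) x)"
proof -
  have init: "initial mach = conf Init 0 (\<lambda>_ _. 0) (\<lambda>_. 0)"
    by (auto simp: initial_def conf_def mach_def intro: nth_equalityI)
  let ?acts = "map (\<lambda>w. (3, Right)) (scanned (\<lambda>_ _. 0) (\<lambda>_. 0)) :: (nat \<times> dir) list"
  show ?thesis
    unfolding init
  proof (rule runs_conf)
    show "step Init (read_input x 0) (scanned (\<lambda>_ _. 0) (\<lambda>_. 0)) = {(Read 0, Right, ?acts)}"
      by simp
    show "length ?acts = N" by (simp add: length_scanned)
    have "conf (Read 0) (min (move Right 0) (length x + 1)) (\<lambda>j. (\<lambda>_. 0)(0 := fst (?acts ! j)))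
        (\<lambda>j. move (snd (?acts ! j)) 0) = conf (Read 0) 1 (\<lambda>j. numtape ((\<lambda>_. 0) j)) (\<lambda>_. 1)"
      unfolding move.simps
      by (simp, rule conf_cong) (auto simp: length_scanned numtape_def dig_0 fun_eq_iff)
    then show "runs mach x (bitlen (length x) + 2) (conf (Read 0) (min (move Right 0) (length x + 1))
        (\<lambda>j. (\<lambda>_. 0)(0 := fst (?acts ! j))) (\<lambda>j. move (snd (?acts ! j)) 0)) (read_count 0 (\<lambda>_. 0) x)"
      using runs_Read[of 1 x x "\<lambda>_. 0" "bitlen (length x) + 2" 0] by simp
  qed simp
qed

lemma read_count_in_sharpL: "read_count 0 (\<lambda>_. 0) \<in> sharpL"
  unfolding sharpL_def mem_Collect_eq
proof (intro exI conjI allI)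
  show "ntm mach" by (rule ntm_mach)
  show "(\<lambda>m. real (bitlen m + 2)) \<in> O(\<lambda>m. ln (real m))" by (rule bitlen_bigo)
  fix x
  show "halts_on_every_path mach x" "space_le mach x (bitlen (length x) + 2)"
    "read_count 0 (\<lambda>_. 0) x = card (accepting_paths mach x)"
    using runs_initial[OF runs_mach] by simp_all
qed

lemma unary_join_Suc: "unary_join (Suc k # ks) = True # unary_join (k # ks)"
  by (cases ks) auto

lemma read_count_unary_join:
  assumes "p + length (k # ks) = N"
  shows "read_count p V (unary_join (k # ks)) =
    final_count (\<lambda>j. V j + (if p \<le> j \<and> j < N then (k # ks) ! (j - p) else 0))"
  using assms
proof (induction ks arbitrary: p k V)
  case Nil
  then show ?case
  proof (induction k arbitrary: V)
    case 0
    then have "(\<lambda>j. V j + (if p \<le> j \<and> j < N then [0] ! (j - p) else 0)) = V"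
      by (auto simp: fun_eq_iff)
    then show ?case using 0 by simp
  next
    case (Suc k)
    have "(\<lambda>j. (V(p := Suc (V p))) j + (if p \<le> j \<and> j < N then [k] ! (j - p) else 0)) =
        (\<lambda>j. V j + (if p \<le> j \<and> j < N then [Suc k] ! (j - p) else 0))"
      using Suc.prems by (auto simp: fun_eq_iff nth_Cons split: nat.splits)
    then show ?case using Suc unfolding unary_join_Suc by simp
  qed
next
  case (Cons l ks)
  from Cons.prems show ?case
  proof (induction k arbitrary: V)
    case 0
    have "(\<lambda>j. V j + (if Suc p \<le> j \<and> j < N then (l # ks) ! (j - Suc p) else 0)) =
        (\<lambda>j. V j + (if p \<le> j \<and> j < N then (0 # l # ks) ! (j - p) else 0))"
      by (auto simp: fun_eq_iff nth_Cons' diff_Suc split: nat.splits)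
    then show ?case using 0 Cons.IH[of "Suc p" l V] by simp
  next
    case (Suc k)
    have "(\<lambda>j. (V(p := Suc (V p))) j + (if p \<le> j \<and> j < N then (k # l # ks) ! (j - p) else 0)) =
        (\<lambda>j. V j + (if p \<le> j \<and> j < N then (Suc k # l # ks) ! (j - p) else 0))"
      using Suc.prems by (auto simp: fun_eq_iff nth_Cons split: nat.splits)
    then show ?case using Suc unfolding unary_join_Suc by simp
  qed
qed

text \<open>Used in contrapositive form: strings with the wrong number of blocks get the value
  0.\<close>

lemma read_count_nonzero:
  assumes "read_count p V ys \<noteq> 0" "p < N"
  shows "\<exists>ks. p + length ks = N \<and> ys = unary_join ks"
  using assms
proof (induction ys arbitrary: p V)
  case Nil
  \<comment> \<open>An exhausted input is a last block of length 0.\<close>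
  then show ?case by (auto split: if_splits intro!: exI[of _ "[0]"])
next
  case (Cons y ys)
  show ?case
  proof (cases y)
    case True
    then have "read_count p (V(p := Suc (V p))) ys \<noteq> 0" using Cons.prems by simp
    from Cons.IH[OF this Cons.prems(2)] obtain ks where ks: "p + length ks = N" "ys = unary_join ks"
      by blast
    then obtain k ks' where "ks = k # ks'" using Cons.prems by (cases ks) auto
    then show ?thesis using ks True by (auto simp: unary_join_Suc intro!: exI[of _ "Suc k # ks'"])
  next
    case False
    then have p: "Suc p < N" using Cons.prems by (auto split: if_splits)
    then obtain ks where ks: "Suc p + length ks = N" "ys = unary_join ks"
      using Cons.IH[of "Suc p" V] Cons.prems False by auto
    then obtain k ks' where "ks = k # ks'" using p by (cases ks) auto
    then show ?thesis using ks False by (auto intro!: exI[of _ "0 # k # ks'"])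
  qed
qed

section \<open>The machine counts the integer solutions\<close>

definition system_count :: "nat list \<Rightarrow> nat" where
  "system_count ks = card {v. length v = r \<and>
     (\<forall>a\<in>set A. 0 \<le> (\<Sum>j<N + r. a j * int ((ks @ v) ! j)))}"

text \<open>The sweep only tries unknowns with at most \<open>width V\<close> digits. By
  \<open>bounded\<close> every solution lies below some given value, so none is lost.\<close>

lemma final_count_eq:
  assumes "length ks = N" "\<And>j. j < N \<Longrightarrow> V j = ks ! j"
    and bounded: "\<And>v y. length v = r \<Longrightarrow> \<forall>a\<in>set A. 0 \<le> (\<Sum>j<N + r. a j * int ((ks @ v) ! j)) \<Longrightarrow>
      y \<in> set v \<Longrightarrow> \<exists>k\<in>set ks. y \<le> k"
  shows "final_count V = system_count ks"
proof -
  have w: "V j < 2 ^ width V" if "j < N" for j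
  proof -
    \<comment> \<open>Any common bound serves here; it only shows that the minimum defining
      \<open>width\<close> exists.\<close>
    have "V j < 2 ^ (\<Sum>j<N. V j)" if "j < N" for j
    proof -
      have "V j \<le> (\<Sum>j<N. V j)" using that by (intro member_le_sum) auto
      then show ?thesis using less_exp[of "\<Sum>j<N. V j"] by (meson le_less_trans)
    qed
    from width_iff(1)[of V _ "width V", OF this] that show ?thesis by simp
  qed
  have sum: "(\<Sum>j<N + r. a j * int ((ks @ v) ! j)) =
      (\<Sum>j<N. a j * int (V j)) + (\<Sum>j<r. a (N + j) * int (v ! j))" for a :: "nat \<Rightarrow> int" and v
  proof -
    have "(\<Sum>j<N + m. a j * int ((ks @ v) ! j)) =
        (\<Sum>j<N. a j * int (V j)) + (\<Sum>j<m. a (N + j) * int (v ! j))" for m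
      by (induction m) (auto simp: assms(1,2) nth_append intro!: sum.cong)
    then show ?thesis .
  qed
  have "solutions (width V) 0 V (replicate (length A) 0) =
      {v. length v = r \<and> (\<forall>a\<in>set A. 0 \<le> (\<Sum>j<N + r. a j * int ((ks @ v) ! j)))}" (is "?l = ?r")
  proof (intro set_eqI iffI)
    fix v assume "v \<in> ?l"
    then show "v \<in> ?r" by (auto simp: solutions_def sum all_set_conv_all_nth)
  next
    fix v assume v: "v \<in> ?r"
    have "set v \<subseteq> {..<2 ^ width V}"
    proof
      fix y assume "y \<in> set v"
      then obtain j where "j < N" "y \<le> ks ! j"
        using bounded[of v y] v assms(1) by (auto simp: in_set_conv_nth)
      then show "y \<in> {..<2 ^ width V}" using w[of j] assms(2)[of j] by simp
    qed
    then show "v \<in> ?l" using v by (auto simp: solutions_def sum)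
  qed
  then show ?thesis by (simp add: final_count_def system_count_def)
qed

theorem system_count_sharpL:
  assumes bounded: "\<And>ks v y. length ks = N \<Longrightarrow> length v = r \<Longrightarrow>
    \<forall>a\<in>set A. 0 \<le> (\<Sum>j<N + r. a j * int ((ks @ v) ! j)) \<Longrightarrow> y \<in> set v \<Longrightarrow> \<exists>k\<in>set ks. y \<le> k"
  shows "\<exists>f\<in>sharpL. (\<forall>ks. length ks = N \<longrightarrow> f (unary_join ks) = system_count ks) \<and>
    (\<forall>w. (\<nexists>ks. length ks = N \<and> w = unary_join ks) \<longrightarrow> f w = 0)"
proof (rule bexI[OF _ read_count_in_sharpL], intro conjI allI impI)
  fix ks :: "nat list" assume len: "length ks = N"
  show "read_count 0 (\<lambda>_. 0) (unary_join ks) = system_count ks"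
  proof (cases ks)
    case Nil
    \<comment> \<open>For \<open>N = 0\<close> the empty string encodes the empty list; this is why
      reading may end at any \<open>p\<close> with \<open>N \<le> Suc p\<close>.\<close>
    have "N \<le> Suc 0" using len Nil by simp
    then have "read_count 0 (\<lambda>_. 0) (unary_join ks) = final_count (\<lambda>_. 0)" by (simp add: Nil)
    also have "\<dots> = system_count ks"
      by (rule final_count_eq[OF len _ bounded[OF len]]) (use len Nil in auto)
    finally show ?thesis .
  next
    case (Cons k ks')
    have "read_count 0 (\<lambda>_. 0) (unary_join ks) =
        final_count (\<lambda>j. 0 + (if 0 \<le> j \<and> j < N then ks ! (j - 0) else 0))"
      unfolding Cons by (rule read_count_unary_join) (use len Cons in simp)
    also have "\<dots> = system_count ks"
      by (rule final_count_eq[OF len _ bounded[OF len]]) auto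
    finally show ?thesis .
  qed
next
  fix w assume w: "\<nexists>ks. length ks = N \<and> w = unary_join ks"
  show "read_count 0 (\<lambda>_. 0) w = 0"
  proof (cases "N = 0")
    case True
    then have "w \<noteq> []" using w by auto
    then obtain y ys where ys: "w = y # ys" by (cases w) auto
    have n: "\<not> 0 < N" "\<not> Suc 0 < N" using True by auto
    show ?thesis unfolding ys by (cases y) (simp_all add: n)
  next
    case False
    then show ?thesis using read_count_nonzero[of 0 "\<lambda>_. 0" w] w by auto
  qed
qed

end

section \<open>Littlewood--Richardson coefficients as numbers of solutions\<close>

definition lin_form :: "nat \<Rightarrow> (nat list \<Rightarrow> int) \<Rightarrow> bool" where
  "lin_form d f \<longleftrightarrow> (\<exists>a. \<forall>x. f x = (\<Sum>j<d. a j * int (x ! j)))"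

text \<open>Only the existence of coefficient rows matters, so closure rules can assemble them from
  the shape of a formula and no matrix is written out.\<close>

definition lin_set :: "nat \<Rightarrow> (nat list \<Rightarrow> bool) \<Rightarrow> bool" where
  "lin_set d P \<longleftrightarrow> (\<exists>A. \<forall>x. P x \<longleftrightarrow> (\<forall>a\<in>set A. 0 \<le> (\<Sum>j<d. a j * int (x ! j))))"

lemma lin_form_nth:
  assumes "j < d"
  shows "lin_form d (\<lambda>x. int (x ! j))"
proof -
  have "(\<Sum>i<d. of_bool (i = j) * int (x ! i)) = (\<Sum>i<d. if i = j then int (x ! j) else 0)" for x
    by (intro sum.cong) auto
  then show ?thesis
    unfolding lin_form_def using assms by (intro exI[of _ "\<lambda>i. of_bool (i = j)"]) simp
qed

lemma lin_form_0: "lin_form d (\<lambda>x. 0)"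
  unfolding lin_form_def by (rule exI[of _ "\<lambda>i. 0"]) simp

lemma lin_form_add:
  assumes "lin_form d f" "lin_form d g"
  shows "lin_form d (\<lambda>x. f x + g x)"
proof -
  obtain a b where ab: "\<forall>x. f x = (\<Sum>j<d. a j * int (x ! j))" "\<forall>x. g x = (\<Sum>j<d. b j * int (x ! j))"
    using assms unfolding lin_form_def by blast
  show ?thesis
    unfolding lin_form_def
    by (rule exI[of _ "\<lambda>j. a j + b j"]) (simp add: ab sum.distrib distrib_right)
qed

lemma lin_form_diff:
  assumes "lin_form d f" "lin_form d g"
  shows "lin_form d (\<lambda>x. f x - g x)"
proof -
  obtain a b where ab: "\<forall>x. f x = (\<Sum>j<d. a j * int (x ! j))" "\<forall>x. g x = (\<Sum>j<d. b j * int (x ! j))"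
    using assms unfolding lin_form_def by blast
  show ?thesis
    unfolding lin_form_def
    by (rule exI[of _ "\<lambda>j. a j - b j"]) (simp add: ab sum_subtractf left_diff_distrib)
qed

lemma lin_form_sum:
  assumes "finite I" "\<And>i. i \<in> I \<Longrightarrow> lin_form d (f i)"
  shows "lin_form d (\<lambda>x. \<Sum>i\<in>I. f i x)"
  using assms by (induction I rule: finite_induct) (auto intro: lin_form_0 lin_form_add)

lemma lin_set_le:
  assumes "lin_form d f" "lin_form d g"
  shows "lin_set d (\<lambda>x. f x \<le> g x)"
proof -
  obtain a where "\<forall>x. g x - f x = (\<Sum>j<d. a j * int (x ! j))"
    using lin_form_diff[OF assms(2,1)] unfolding lin_form_def by blast
  then have "f x \<le> g x \<longleftrightarrow> 0 \<le> (\<Sum>j<d. a j * int (x ! j))" for x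
    by (metis diff_ge_0_iff_ge)
  then show ?thesis unfolding lin_set_def by (intro exI[of _ "[a]"]) simp
qed

lemma lin_set_conj:
  assumes "lin_set d P" "lin_set d Q"
  shows "lin_set d (\<lambda>x. P x \<and> Q x)"
proof -
  obtain A B where "\<forall>x. P x \<longleftrightarrow> (\<forall>a\<in>set A. 0 \<le> (\<Sum>j<d. a j * int (x ! j)))"
    "\<forall>x. Q x \<longleftrightarrow> (\<forall>a\<in>set B. 0 \<le> (\<Sum>j<d. a j * int (x ! j)))"
    using assms unfolding lin_set_def by blast
  then show ?thesis unfolding lin_set_def by (intro exI[of _ "A @ B"]) (simp add: ball_Un)
qed

lemma lin_set_eq:
  "lin_form d f \<Longrightarrow> lin_form d g \<Longrightarrow> lin_set d (\<lambda>x. f x = g x)"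
  unfolding order_eq_iff by (intro lin_set_conj lin_set_le)

lemma lin_set_True: "lin_set d (\<lambda>x. True)"
  unfolding lin_set_def by (rule exI[of _ "[]"]) simp

lemma lin_set_ball:
  assumes "finite I" "\<And>i. i \<in> I \<Longrightarrow> lin_set d (P i)"
  shows "lin_set d (\<lambda>x. \<forall>i\<in>I. P i x)"
  using assms by (induction I rule: finite_induct) (auto intro: lin_set_True lin_set_conj)

text \<open>Unknowns \<open>0, \<dots>, 3 n - 1\<close> are the parts of \<open>lam\<close>, \<open>mu\<close>, \<open>nu\<close>; the pattern follows row by row.\<close>

definition lr_system :: "nat \<Rightarrow> nat list \<Rightarrow> bool" where
  "lr_system n x \<longleftrightarrow>
     (let G = \<lambda>k i. int (x ! (3 * n + k * n + i)) in
     (\<forall>m\<in>{0, n, 2 * n}. \<forall>k\<in>{k. Suc k < n}. int (x ! (m + Suc k)) \<le> int (x ! (m + k))) \<and>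
     (\<forall>i\<in>{..<n}. G 0 i = 0 \<and> G n i = int (x ! (2 * n + i))) \<and>
     (\<forall>k\<in>{..<n}. \<forall>i\<in>{..<n}. G k i \<le> G (Suc k) i) \<and>
     (\<forall>k\<in>{..<n}. \<forall>i\<in>{i. Suc i < n}. G (Suc k) (Suc i) \<le> G k i) \<and>
     (\<forall>k\<in>{k. Suc k < n}. \<forall>i\<in>{..<n}.
        int (x ! (n + Suc k)) + (\<Sum>i'\<in>{..<Suc i}. G (Suc (Suc k)) i' - G (Suc k) i')
          \<le> int (x ! (n + k)) + (\<Sum>i'\<in>{..<i}. G (Suc k) i' - G k i')) \<and>
     (\<forall>k\<in>{..<n}. int (x ! (n + k)) + (\<Sum>i\<in>{..<n}. G (Suc k) i - G k i) = int (x ! (0 + k))))"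

lemma index_less:
  assumes "k \<le> n" "i < n"
  shows "k * n + i < Suc n * n"
proof -
  have "k * n \<le> n * n" using assms by simp
  then show ?thesis using assms unfolding mult_Suc by linarith
qed

text \<open>The shape of \<open>lr_system\<close> is made for these rules: quantifiers and sums
  range over finite sets, and the given parts appear uniformly as \<open>m + k\<close>, even as
  \<open>0 + k\<close>.\<close>

lemma lin_set_lr_system: "lin_set (3 * n + Suc n * n) (lr_system n)"
proof -
  have fin: "finite {k. Suc k < n}" by (rule finite_subset[of _ "{..<n}"]) auto
  have G: "lin_form (3 * n + Suc n * n) (\<lambda>x. int (x ! (3 * n + k * n + i)))" if "k \<le> n" "i < n" for k i
    using index_less[OF that] by (intro lin_form_nth) simp
  have I: "lin_form (3 * n + Suc n * n) (\<lambda>x. int (x ! (m + k)))" if "m \<in> {0, n, 2 * n}" "k < n" for m k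
    using that by (intro lin_form_nth) auto
  show ?thesis
    unfolding lr_system_def[abs_def] Let_def
    by (intro lin_set_conj lin_set_ball lin_set_le lin_set_eq lin_form_add lin_form_diff lin_form_sum
        G I lin_form_0 fin finite_lessThan finite.intros) auto
qed

section \<open>Patterns as lists of unknowns\<close>

definition pattern_of_list :: "nat \<Rightarrow> nat list \<Rightarrow> nat \<Rightarrow> nat \<Rightarrow> nat" where
  "pattern_of_list n v k i = (if k \<le> n \<and> i < n then v ! (k * n + i) else 0)"

text \<open>The prescribed levels 0 and \<open>n\<close> are stored too, which keeps the numbering
  \<open>k * n + i\<close> uniform; equations in \<open>lr_system\<close> pin them down.\<close>

definition list_of_pattern :: "nat \<Rightarrow> (nat \<Rightarrow> nat \<Rightarrow> nat) \<Rightarrow> nat list" where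
  "list_of_pattern n g = map (\<lambda>j. g (j div n) (j mod n)) [0..<Suc n * n]"

lemma list_of_pattern_of_list:
  assumes "length v = Suc n * n"
  shows "list_of_pattern n (pattern_of_list n v) = v"
proof (rule nth_equalityI)
  show "length (list_of_pattern n (pattern_of_list n v)) = length v"
    by (simp add: list_of_pattern_def assms)
  fix j assume "j < length (list_of_pattern n (pattern_of_list n v))"
  then have j: "j < Suc n * n" by (simp add: list_of_pattern_def)
  then have "0 < n" by (cases n) auto
  moreover have "j div n < Suc n" using j by (simp add: less_mult_imp_div_less)
  ultimately show "list_of_pattern n (pattern_of_list n v) ! j = v ! j"
    using j by (simp add: list_of_pattern_def pattern_of_list_def)
qed

lemma pattern_of_list_of_pattern:
  assumes "\<And>k i. n < k \<or> n \<le> i \<Longrightarrow> g k i = 0"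
  shows "pattern_of_list n (list_of_pattern n g) = g"
proof (intro ext)
  fix k i
  show "pattern_of_list n (list_of_pattern n g) k i = g k i"
  proof (cases "k \<le> n \<and> i < n")
    case True
    then have "list_of_pattern n g ! (k * n + i) = g ((k * n + i) div n) ((k * n + i) mod n)"
      using index_less[of k n i] by (simp add: list_of_pattern_def)
    then show ?thesis using True by (simp add: pattern_of_list_def)
  next
    case False
    then show ?thesis using assms[of k i] by (auto simp: pattern_of_list_def)
  qed
qed

lemma mem_partitions_iff:
  "lam \<in> partitions n \<longleftrightarrow> length lam = n \<and> (\<forall>k. Suc k < n \<longrightarrow> lam ! Suc k \<le> lam ! k)"
  unfolding partitions_def by (auto simp: sorted_wrt_iff_nth_Suc_transp transp_def)

text \<open>The partition conditions are on the right because the system contains them; it thus has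
  no solution for a triple that is not made of partitions.\<close>

lemma lr_system_iff:
  assumes len: "length lam = n" "length mu = n" "length nu = n" "length v = Suc n * n"
  shows "lr_system n (lam @ mu @ nu @ v) \<longleftrightarrow>
    lam \<in> partitions n \<and> mu \<in> partitions n \<and> nu \<in> partitions n \<and>
    pattern_of_list n v \<in> lr_patterns n mu nu lam"
proof -
  let ?x = "lam @ mu @ nu @ v" and ?g = "pattern_of_list n v"
  have lam: "?x ! (0 + k) = lam ! k" and mu: "?x ! (n + k) = mu ! k" and nu: "?x ! (2 * n + k) = nu ! k"
    if "k < n" for k
    using that len by (auto simp: nth_append)
  have g: "?x ! (3 * n + k * n + i) = ?g k i" if "k \<le> n" "i < n" for k i
    using that len by (simp add: nth_append pattern_of_list_def)
  have parts: "(\<forall>m\<in>{0, n, 2 * n}. \<forall>k\<in>{k. Suc k < n}. int (?x ! (m + Suc k)) \<le> int (?x ! (m + k))) \<longleftrightarrow>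
      lam \<in> partitions n \<and> mu \<in> partitions n \<and> nu \<in> partitions n"
    using len lam mu nu by (auto simp: mem_partitions_iff simp del: add_Suc_right)
  have gt: "(\<forall>i\<in>{..<n}. int (?g 0 i) = 0 \<and> int (?g n i) = int (nu ! i)) \<and>
     (\<forall>k\<in>{..<n}. \<forall>i\<in>{..<n}. int (?g k i) \<le> int (?g (Suc k) i)) \<and>
     (\<forall>k\<in>{..<n}. \<forall>i\<in>{i. Suc i < n}. int (?g (Suc k) (Suc i)) \<le> int (?g k i)) \<longleftrightarrow> ?g \<in> gt n nu" (is "?l \<longleftrightarrow> _")
  proof
    assume l: ?l
    have out: "?g k i = 0" if "n < k \<or> n \<le> i" for k i
      using that by (auto simp: pattern_of_list_def)
    have "?g k i \<le> ?g (Suc k) i \<and> ?g (Suc k) (Suc i) \<le> ?g k i" if "k < n" for k i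
      using l that out[of k i] out[of "Suc k" "Suc i"]
      by (cases "i < n"; cases "Suc i < n") auto
    moreover have "?g 0 i = 0" for i using l out[of 0 i] by (cases "i < n") auto
    ultimately show "?g \<in> gt n nu" using l out by (auto simp: gt_def interlacing_def)
  next
    assume "?g \<in> gt n nu"
    then show ?l by (auto simp: gt_def interlacing_def)
  qed
  define G where "G k i = int (?x ! (3 * n + k * n + i))" for k i
  have G: "G k i = int (?g k i)" if "k \<le> n" "i < n" for k i
    using g[OF that] by (simp only: G_def)
  have L: "lr_system n ?x \<longleftrightarrow>
     (\<forall>m\<in>{0, n, 2 * n}. \<forall>k\<in>{k. Suc k < n}. int (?x ! (m + Suc k)) \<le> int (?x ! (m + k))) \<and>
     (\<forall>i\<in>{..<n}. G 0 i = 0 \<and> G n i = int (?x ! (2 * n + i))) \<and>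
     (\<forall>k\<in>{..<n}. \<forall>i\<in>{..<n}. G k i \<le> G (Suc k) i) \<and>
     (\<forall>k\<in>{..<n}. \<forall>i\<in>{i. Suc i < n}. G (Suc k) (Suc i) \<le> G k i) \<and>
     (\<forall>k\<in>{k. Suc k < n}. \<forall>i\<in>{..<n}.
        int (?x ! (n + Suc k)) + (\<Sum>i'<Suc i. G (Suc (Suc k)) i' - G (Suc k) i')
          \<le> int (?x ! (n + k)) + (\<Sum>i'<i. G (Suc k) i' - G k i')) \<and>
     (\<forall>k\<in>{..<n}. int (?x ! (n + k)) + (\<Sum>i<n. G (Suc k) i - G k i) = int (?x ! (0 + k)))"
    unfolding lr_system_def Let_def G_def by (rule refl)
  have s: "(\<Sum>i'<m. G (Suc k) i' - G k i') = (\<Sum>i'<m. int (?g (Suc k) i') - int (?g k i'))"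
    if "k < n" "m \<le> n" for k m
    using that G by (intro sum.cong) auto
  have h2: "(\<forall>i\<in>{..<n}. G 0 i = 0 \<and> G n i = int (?x ! (2 * n + i))) \<longleftrightarrow>
      (\<forall>i\<in>{..<n}. int (?g 0 i) = 0 \<and> int (?g n i) = int (nu ! i))"
    by (intro ball_cong refl) (simp only: G nu lessThan_iff le0 order_refl)
  have h3: "(\<forall>k\<in>{..<n}. \<forall>i\<in>{..<n}. G k i \<le> G (Suc k) i) \<longleftrightarrow>
      (\<forall>k\<in>{..<n}. \<forall>i\<in>{..<n}. int (?g k i) \<le> int (?g (Suc k) i))"
    by (intro ball_cong refl) (simp add: G)
  have h4: "(\<forall>k\<in>{..<n}. \<forall>i\<in>{i. Suc i < n}. G (Suc k) (Suc i) \<le> G k i) \<longleftrightarrow>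
      (\<forall>k\<in>{..<n}. \<forall>i\<in>{i. Suc i < n}. int (?g (Suc k) (Suc i)) \<le> int (?g k i))"
    by (intro ball_cong refl) (simp add: G)
  have h5: "(\<forall>k\<in>{k. Suc k < n}. \<forall>i\<in>{..<n}.
        int (?x ! (n + Suc k)) + (\<Sum>i'<Suc i. G (Suc (Suc k)) i' - G (Suc k) i')
          \<le> int (?x ! (n + k)) + (\<Sum>i'<i. G (Suc k) i' - G k i')) \<longleftrightarrow>
     (\<forall>k i. Suc k < n \<and> i < n \<longrightarrow>
        int (mu ! Suc k) + (\<Sum>i'<Suc i. int (?g (Suc (Suc k)) i') - int (?g (Suc k) i'))
          \<le> int (mu ! k) + (\<Sum>i'<i. int (?g (Suc k) i') - int (?g k i')))"
  proof -
    have "int (?x ! (n + Suc k)) + (\<Sum>i'<Suc i. G (Suc (Suc k)) i' - G (Suc k) i')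
          \<le> int (?x ! (n + k)) + (\<Sum>i'<i. G (Suc k) i' - G k i') \<longleftrightarrow>
        int (mu ! Suc k) + (\<Sum>i'<Suc i. int (?g (Suc (Suc k)) i') - int (?g (Suc k) i'))
          \<le> int (mu ! k) + (\<Sum>i'<i. int (?g (Suc k) i') - int (?g k i'))"
      if k: "Suc k < n" and i: "i < n" for k i
      unfolding mu[OF k] mu[OF Suc_lessD[OF k]] s[OF k Suc_leI[OF i]]
        s[OF Suc_lessD[OF k] less_imp_le[OF i]] by (rule refl)
    then show ?thesis unfolding Ball_def mem_Collect_eq lessThan_iff by blast
  qed
  have h6: "(\<forall>k\<in>{..<n}. int (?x ! (n + k)) + (\<Sum>i<n. G (Suc k) i - G k i) = int (?x ! (0 + k))) \<longleftrightarrow>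
     (\<forall>k<n. int (mu ! k) + (\<Sum>i<n. int (?g (Suc k) i) - int (?g k i)) = int (lam ! k))"
  proof -
    have "int (?x ! (n + k)) + (\<Sum>i<n. G (Suc k) i - G k i) = int (?x ! (0 + k)) \<longleftrightarrow>
        int (mu ! k) + (\<Sum>i<n. int (?g (Suc k) i) - int (?g k i)) = int (lam ! k)"
      if k: "k < n" for k
      unfolding mu[OF k] lam[OF k] s[OF k order_refl] by (rule refl)
    then show ?thesis unfolding Ball_def lessThan_iff by blast
  qed
  have "lr_system n ?x \<longleftrightarrow>
     (lam \<in> partitions n \<and> mu \<in> partitions n \<and> nu \<in> partitions n) \<and> ?g \<in> gt n nu \<and>
     (\<forall>k i. Suc k < n \<and> i < n \<longrightarrow>
        int (mu ! Suc k) + (\<Sum>i'<Suc i. int (?g (Suc (Suc k)) i') - int (?g (Suc k) i'))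
          \<le> int (mu ! k) + (\<Sum>i'<i. int (?g (Suc k) i') - int (?g k i'))) \<and>
     (\<forall>k<n. int (mu ! k) + (\<Sum>i<n. int (?g (Suc k) i) - int (?g k i)) = int (lam ! k))"
    unfolding L parts h2 h3 h4 h5 h6 gt[symmetric] by (simp only: conj_assoc)
  also have "\<dots> \<longleftrightarrow> lam \<in> partitions n \<and> mu \<in> partitions n \<and> nu \<in> partitions n \<and>
    ?g \<in> lr_patterns n mu nu lam"
  proof -
    have w: "int (mu ! k) + (\<Sum>i<n. int (?g (Suc k) i) - int (?g k i)) = int (lam ! k) \<longleftrightarrow>
        mu ! k + wt n ?g k = lam ! k" if "?g \<in> gt n nu" "k < n" for k
      using int_wt[OF that] by (simp add: sum_subtractf) linarith
    show ?thesis
      using w yamanouchi_iff[of ?g n nu "(!) mu"] decr_nth[of mu n] by (auto simp: lr_patterns_def)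
  qed
  finally show ?thesis .
qed

lemma split_three:
  assumes "length ks = 3 * n"
  shows "\<exists>lam mu nu. ks = lam @ mu @ nu \<and> length lam = n \<and> length mu = n \<and> length nu = n"
  by (rule exI[of _ "take n ks"], rule exI[of _ "take n (drop n ks)"], rule exI[of _ "drop n (drop n ks)"])
    (use assms in \<open>simp del: drop_drop\<close>)

text \<open>The levels of a pattern grow up to the last one, which is \<open>nu\<close>. This is the
  boundedness that allows the sweep to stop with the last digit of the given numbers.\<close>

lemma lr_system_bounded:
  assumes "length ks = 3 * n" "length v = Suc n * n" "lr_system n (ks @ v)" "y \<in> set v"
  shows "\<exists>k\<in>set ks. y \<le> k"
proof -
  obtain lam mu nu where ks: "ks = lam @ mu @ nu"
    and len: "length lam = n" "length mu = n" "length nu = n"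
    using split_three[OF assms(1)] by blast
  have g: "pattern_of_list n v \<in> gt n nu"
    using lr_system_iff[OF len assms(2)] assms(3) by (simp add: ks lr_patterns_def)
  obtain j where j: "j < Suc n * n" "y = v ! j" using assms(2,4) by (metis in_set_conv_nth)
  then have n: "0 < n" by (cases n) auto
  have "j div n < Suc n" using j(1) by (simp add: less_mult_imp_div_less)
  then have "y = pattern_of_list n v (j div n) (j mod n)" using n j by (simp add: pattern_of_list_def)
  also have "\<dots> \<le> pattern_of_list n v n (j mod n)"
    using gt_mono[OF g] \<open>j div n < Suc n\<close> by simp
  also have "\<dots> = nu ! (j mod n)" using g n by (simp add: gt_def)
  finally show ?thesis using n len by (intro bexI[of _ "nu ! (j mod n)"]) (auto simp: ks)
qed

lemma card_lr_system:
  assumes "lam \<in> partitions n" "mu \<in> partitions n" "nu \<in> partitions n"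
  shows "card {v. length v = Suc n * n \<and> lr_system n ((lam @ mu @ nu) @ v)} = card (lr_patterns n mu nu lam)"
proof (rule bij_betw_same_card[of "pattern_of_list n"],
    rule bij_betw_byWitness[where f' = "list_of_pattern n"])
  have len: "length lam = n" "length mu = n" "length nu = n" using assms by (auto simp: partitions_def)
  have out: "g k i = 0" if "g \<in> lr_patterns n mu nu lam" "n < k \<or> n \<le> i" for g k i
    using that unfolding lr_patterns_def gt_def by blast
  show "\<forall>v\<in>{v. length v = Suc n * n \<and> lr_system n ((lam @ mu @ nu) @ v)}.
      list_of_pattern n (pattern_of_list n v) = v"
    using list_of_pattern_of_list by blast
  show inv: "\<forall>g\<in>lr_patterns n mu nu lam. pattern_of_list n (list_of_pattern n g) = g"
    using pattern_of_list_of_pattern out by blast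
  show "pattern_of_list n ` {v. length v = Suc n * n \<and> lr_system n ((lam @ mu @ nu) @ v)}
      \<subseteq> lr_patterns n mu nu lam"
    using lr_system_iff[OF len] by auto
  show "list_of_pattern n ` lr_patterns n mu nu lam
      \<subseteq> {v. length v = Suc n * n \<and> lr_system n ((lam @ mu @ nu) @ v)}"
  proof
    fix v assume "v \<in> list_of_pattern n ` lr_patterns n mu nu lam"
    then obtain g where g: "g \<in> lr_patterns n mu nu lam" "v = list_of_pattern n g" by blast
    have l: "length v = Suc n * n" by (simp add: g list_of_pattern_def)
    then show "v \<in> {v. length v = Suc n * n \<and> lr_system n ((lam @ mu @ nu) @ v)}"
      using lr_system_iff[OF len l] inv g assms by simp
  qed
qed

theorem theorem4p7:
  fixes n :: nat
  shows "\<exists>f\<in>sharpL.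
    (\<forall>lam\<in>partitions n. \<forall>mu\<in>partitions n. \<forall>nu\<in>partitions n.
       f (encode lam mu nu) = lr_coeff n mu nu lam) \<and>
    (\<forall>w. (\<nexists>lam mu nu. lam \<in> partitions n \<and> mu \<in> partitions n \<and> nu \<in> partitions n \<and>
                      w = encode lam mu nu) \<longrightarrow> f w = 0)"
proof -
  \<comment> \<open>The rows depend on \<open>n\<close> alone, so one machine serves all
    triples.\<close>
  obtain A where A: "\<And>x. lr_system n x \<longleftrightarrow> (\<forall>a\<in>set A. 0 \<le> (\<Sum>j<3 * n + Suc n * n. a j * int (x ! j)))"
    using lin_set_lr_system unfolding lin_set_def by blast
  have count: "linear_system.system_count (3 * n) (Suc n * n) A ks =
      card {v. length v = Suc n * n \<and> lr_system n (ks @ v)}" for ks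
    unfolding linear_system.system_count_def A ..
  obtain f where f: "f \<in> sharpL"
    "\<And>ks. length ks = 3 * n \<Longrightarrow> f (unary_join ks) = card {v. length v = Suc n * n \<and> lr_system n (ks @ v)}"
    "\<And>w. \<nexists>ks. length ks = 3 * n \<and> w = unary_join ks \<Longrightarrow> f w = 0"
    using linear_system.system_count_sharpL[of "3 * n" "Suc n * n" A, unfolded count, folded A]
      lr_system_bounded by blast
  show ?thesis
  proof (rule bexI[OF _ f(1)], intro conjI ballI allI impI)
    fix lam mu nu assume p: "lam \<in> partitions n" "mu \<in> partitions n" "nu \<in> partitions n"
    then have "length (lam @ mu @ nu) = 3 * n" by (simp add: partitions_def)
    then show "f (encode lam mu nu) = lr_coeff n mu nu lam"
      using f(2) card_lr_system[OF p] lr_coeff_eq_card[OF p(2,3,1)] by (simp add: encode_def)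
  next
    fix w assume w: "\<nexists>lam mu nu. lam \<in> partitions n \<and> mu \<in> partitions n \<and> nu \<in> partitions n \<and>
                      w = encode lam mu nu"
    show "f w = 0"
    proof (cases "\<exists>ks. length ks = 3 * n \<and> w = unary_join ks")
      case True
      then obtain ks where ks: "length ks = 3 * n" "w = unary_join ks" by blast
      obtain lam mu nu where eq: "ks = lam @ mu @ nu"
        and len: "length lam = n" "length mu = n" "length nu = n"
        using split_three[OF ks(1)] by blast
      \<comment> \<open>The string has the right number of blocks, but they are not three
        partitions; then the system is unsolvable and the count is 0.\<close>
      have "\<not> (lam \<in> partitions n \<and> mu \<in> partitions n \<and> nu \<in> partitions n)"
        using w ks(2) eq by (auto simp: encode_def)
      then have "{v. length v = Suc n * n \<and> lr_system n (ks @ v)} = {}"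
        using lr_system_iff[OF len] by (auto simp: eq)
      then show ?thesis unfolding ks(2) f(2)[OF ks(1)] by (simp only: card.empty)
    next
      case False
      then show ?thesis by (rule f(3))
    qed
  qed
qed

end
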